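(* Let $p\in\mathscr P^{\log}(\mathbb C)$ and $p'(z)=\frac{p(z)}{p(z)-1}$. For $h\in\mathcal F^{p'(\cdot)}$ define $\Lambda_h(f)=\langle f,h\rangle=\frac{2}{\pi}\int_{\mathbb C}f(z)\overline{h(z)}e^{-2|z|^2}\,dA(z)$ for $f\in\mathcal F^{p(\cdot)}$. Then each $\Lambda_h$ is a bounded linear functional on $\mathcal F^{p(\cdot)}$, every bounded linear functional $\Lambda$ on $\mathcal F^{p(\cdot)}$ equals $\Lambda_h$ for some $h\in\mathcal F^{p'(\cdot)}$, and $\|\Lambda_h\|\asymp\|h\|_{\mathcal F^{p'(\cdot)}}$ with constants independent of $h$. Thus the dual of $\mathcal F^{p(\cdot)}$ is isomorphic to $\mathcal F^{p'(\cdot)}$.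
   Context: $A$ denotes Lebesgue area measure on $\mathbb C$. A variable exponent is a measurable function $p:\mathbb C\to[1,\infty)$; $p^+=\operatorname{ess\,sup}_{\mathbb C}p$, $p^-=\operatorname{ess\,inf}_{\mathbb C}p$. $\mathscr P^{\log}(\mathbb C)$ is the set of variable exponents $p$ with $1<p^-\le p^+<\infty$ that are globally log-H\"older continuous: there is $C_{\log}>0$ with $|p(z)-p(w)|\le C_{\log}/\log(1/|z-w|)$ whenever $|z-w|<1/2$, and there exist $p_\infty\in[1,\infty)$ and $C>0$ with $|p(z)-p_\infty|\le C/\log(e+|z|)$ for all $z$. For a measurable exponent $q:\mathbb C\to[1,\infty)$, $\mathcal L^{q(\cdot)}$ is the space of measurable $f$ with $\int_{\mathbb C}(\lambda|f(z)|)^{q(z)}e^{-q(z)|z|^2}\,dA(z)<\infty$ for some $\lambda>0$, normed by $\|f\|_{\mathcal L^{q(\cdot)}}=\inf\{\lambda>0:\int_{\mathbb C}(|f(z)|/\lambda)^{q(z)}e^{-q(z)|z|^2}\,dA(z)\le1\}$, and the variable exponent Fock space $\mathcal F^{q(\cdot)}$ is the set of entire functions in $\mathcal L^{q(\cdot)}$ with the same norm. $a\asymp b$ means $a\le Cb$ and $b\le Ca$ for a constant $C>0$. *)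

theory Defs
  imports "HOL-Analysis.Analysis"
begin

definition Plog :: "(complex \<Rightarrow> real) \<Rightarrow> bool" where
  "Plog p \<longleftrightarrow>
     p \<in> borel_measurable lborel \<and> (\<forall>z. 1 \<le> p z) \<and>
     (\<exists>a. 1 < a \<and> (AE z in lborel. a \<le> p z)) \<and>
     (\<exists>b. AE z in lborel. p z \<le> b) \<and>
     (\<exists>Clog>0. \<forall>z w. 0 < cmod (z - w) \<and> cmod (z - w) < 1/2 \<longrightarrow>
          \<bar>p z - p w\<bar> \<le> Clog / ln (1 / cmod (z - w))) \<and>
     (\<exists>pinf C. 1 \<le> pinf \<and> 0 < C \<and>
          (\<forall>z. \<bar>p z - pinf\<bar> \<le> C / ln (exp 1 + cmod z)))"

definition conj_exp :: "(complex \<Rightarrow> real) \<Rightarrow> complex \<Rightarrow> real" where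
  "conj_exp p = (\<lambda>z. p z / (p z - 1))"

definition modular :: "(complex \<Rightarrow> real) \<Rightarrow> (complex \<Rightarrow> complex) \<Rightarrow> ennreal" where
  "modular q f = (\<integral>\<^sup>+ z. ennreal ((cmod (f z)) powr (q z) * exp (- q z * (cmod z)\<^sup>2)) \<partial>lborel)"

definition in_L :: "(complex \<Rightarrow> real) \<Rightarrow> (complex \<Rightarrow> complex) \<Rightarrow> bool" where
  "in_L q f \<longleftrightarrow> f \<in> borel_measurable lborel \<and>
     (\<exists>t>0. modular q (\<lambda>z. complex_of_real t * f z) < \<infinity>)"

definition L_norm :: "(complex \<Rightarrow> real) \<Rightarrow> (complex \<Rightarrow> complex) \<Rightarrow> real" where
  "L_norm q f = Inf {t. t > 0 \<and> modular q (\<lambda>z. f z / complex_of_real t) \<le> 1}"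

definition Fock :: "(complex \<Rightarrow> real) \<Rightarrow> (complex \<Rightarrow> complex) set" where
  "Fock q = {f. f holomorphic_on UNIV \<and> in_L q f}"

definition pairing :: "(complex \<Rightarrow> complex) \<Rightarrow> (complex \<Rightarrow> complex) \<Rightarrow> complex" where
  "pairing f h = complex_of_real (2 / pi) *
     (\<integral> z. f z * cnj (h z) * complex_of_real (exp (- 2 * (cmod z)\<^sup>2)) \<partial>lborel)"

definition bounded_functional ::
  "(complex \<Rightarrow> real) \<Rightarrow> ((complex \<Rightarrow> complex) \<Rightarrow> complex) \<Rightarrow> bool" where
  "bounded_functional q \<Lambda> \<longleftrightarrow>
     (\<forall>f\<in>Fock q. \<forall>g\<in>Fock q. \<Lambda> (\<lambda>z. f z + g z) = \<Lambda> f + \<Lambda> g) \<and>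
     (\<forall>f\<in>Fock q. \<forall>c. \<Lambda> (\<lambda>z. c * f z) = c * \<Lambda> f) \<and>
     (\<exists>C. \<forall>f\<in>Fock q. cmod (\<Lambda> f) \<le> C * L_norm q f)"

definition op_norm :: "(complex \<Rightarrow> real) \<Rightarrow> ((complex \<Rightarrow> complex) \<Rightarrow> complex) \<Rightarrow> real" where
  "op_norm q \<Lambda> = Sup {cmod (\<Lambda> f) | f. f \<in> Fock q \<and> L_norm q f \<le> 1}"

end

theory Submission
  imports Defs "HOL-Probability.Probability" "HOL-Complex_Analysis.Complex_Analysis"
begin

text \<open>
  The projection \<open>fock_proj g z = 2/pi \<integral> g(w) exp(2 z cnj w) exp(-2|w|^2)\<close> reproduces Fock functions
  and satisfies \<open>|fock_proj g| exp(-|z|^2) \<le> G * (|g| exp(-|w|^2))\<close> with \<open>G\<close> the Gaussian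
  \<open>exp(-|z|^2)\<close>. Convolution with \<open>G\<close> is bounded on the variable exponent space: the part of a
  function above \<open>1\<close> is integrable, so its average is both bounded and integrable; on functions with
  values in \<open>[0,1]\<close> the decay of \<open>p\<close> at infinity makes the exponents \<open>p\<close> and \<open>pinf\<close> interchangeable up
  to the integrable error \<open>(e + |z|) powr -4\<close>, and for a constant exponent Jensen's inequality applies.

  A bounded functional \<open>\<Lambda>\<close> is represented by \<open>h(w) = cnj (\<Lambda> (exp(2 z cnj w)))\<close>, which avoids extending
  \<open>\<Lambda>\<close> to the Lebesgue space. Expanding in powers gives \<open>\<Lambda> (fock_proj g) = pairing g h\<close> for \<open>g\<close> of
  compact support; a suitable choice of \<open>g\<close> bounds the modular of \<open>h\<close>, and truncating
  \<open>f = fock_proj f\<close> gives \<open>\<Lambda> f = pairing f h\<close>.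
\<close>

section \<open>Lebesgue measure on the complex plane\<close>

text \<open>The formula for \<open>rep\<close> is forced: if
  \<open>\<Lambda> f = pairing f h\<close>, testing on a kernel function and applying the
  reproducing formula returns the value of \<open>h\<close>. The obstacle is the converse, where
  \<open>\<Lambda>\<close> has to pass through an integral over kernel functions although all that
  is known about it is a bound on entire functions. Compact support of \<open>g\<close> overcomes
  this: the power series involved then have coefficients of size \<open>\<rho> ^ n / fact n\<close>,
  their partial sums converge in norm, and \<open>\<Lambda>\<close> may be applied termwise.

  The lower norm bound comes from the same construction. Applied to \<open>pairing f h\<close> as a
  functional of \<open>f\<close>, it returns \<open>rep = h\<close>, so the estimate of
  \<open>rep\<close> by the bound on \<open>\<Lambda>\<close> becomes an estimate of
  \<open>h\<close> by \<open>op_norm\<close>.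

  The local log-Hoelder condition enters through continuity of \<open>p\<close>, which makes the
  essential bounds on \<open>p\<close> valid at every point.\<close>

lemma measurable_Complex_pair [measurable]:
  "(\<lambda>q. Complex (fst q) (snd q)) \<in> borel_measurable (borel \<Otimes>\<^sub>M borel)"
  unfolding borel_prod by (intro borel_measurable_continuous_onI continuous_intros)

text \<open>A measure that gives every box its volume is \<open>lborel\<close>, and boxes in the
  complex plane are products of intervals. Integrals over the plane thereby become iterated real
  integrals.\<close>

lemma lborel_complex_eq_distr:
  "lborel = distr (lborel \<Otimes>\<^sub>M lborel) borel (\<lambda>q. Complex (fst q) (snd q))"
proof (rule lborel_eqI)
  fix l u :: complex
  assume le: "\<And>b. b \<in> Basis \<Longrightarrow> l \<bullet> b \<le> u \<bullet> b"
  have le': "Re l \<le> Re u" "Im l \<le> Im u"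
    using le[of 1] le[of \<i>] by (auto simp: Basis_complex_def)
  have "(\<lambda>q. Complex (fst q) (snd q)) -` box l u \<inter> space (lborel \<Otimes>\<^sub>M lborel)
      = {Re l<..<Re u} \<times> {Im l<..<Im u}"
    by (auto simp: box_def Basis_complex_def space_pair_measure)
  then have "emeasure (distr (lborel \<Otimes>\<^sub>M lborel) borel (\<lambda>q. Complex (fst q) (snd q))) (box l u)
      = emeasure (lborel \<Otimes>\<^sub>M lborel) ({Re l<..<Re u} \<times> {Im l<..<Im u})"
    by (subst emeasure_distr) auto
  also have "\<dots> = ennreal (Re u - Re l) * ennreal (Im u - Im l)"
    using le' by (subst lborel.emeasure_pair_measure_Times) auto
  also have "\<dots> = ennreal (\<Prod>b\<in>Basis. (u - l) \<bullet> b)"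
    using le' by (simp add: Basis_complex_def ennreal_mult)
  finally show "emeasure (distr (lborel \<Otimes>\<^sub>M lborel) borel (\<lambda>q. Complex (fst q) (snd q))) (box l u)
      = (\<Prod>b\<in>Basis. (u - l) \<bullet> b)" .
qed simp

lemma
  fixes f :: "complex \<Rightarrow> ennreal"
  assumes [measurable]: "f \<in> borel_measurable borel"
  shows nn_integral_complex_Re_Im: "(\<integral>\<^sup>+z. f z \<partial>lborel) = (\<integral>\<^sup>+x. \<integral>\<^sup>+y. f (Complex x y) \<partial>lborel \<partial>lborel)"
    and nn_integral_complex_Im_Re: "(\<integral>\<^sup>+z. f z \<partial>lborel) = (\<integral>\<^sup>+y. \<integral>\<^sup>+x. f (Complex x y) \<partial>lborel \<partial>lborel)"
proof -
  have *: "(\<integral>\<^sup>+z. f z \<partial>lborel) = (\<integral>\<^sup>+q. f (Complex (fst q) (snd q)) \<partial>(lborel \<Otimes>\<^sub>M lborel))"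
    by (subst lborel_complex_eq_distr, subst nn_integral_distr) auto
  show "(\<integral>\<^sup>+z. f z \<partial>lborel) = (\<integral>\<^sup>+x. \<integral>\<^sup>+y. f (Complex x y) \<partial>lborel \<partial>lborel)"
    unfolding * by (subst lborel.nn_integral_fst[symmetric]) auto
  show "(\<integral>\<^sup>+z. f z \<partial>lborel) = (\<integral>\<^sup>+y. \<integral>\<^sup>+x. f (Complex x y) \<partial>lborel \<partial>lborel)"
    unfolding * by (subst lborel_pair.nn_integral_snd[symmetric]) auto
qed

lemma nn_integral_lborel_translate:
  fixes f :: "'a::euclidean_space \<Rightarrow> ennreal"
  assumes [measurable]: "f \<in> borel_measurable borel"
  shows "(\<integral>\<^sup>+x. f (c + x) \<partial>lborel) = (\<integral>\<^sup>+x. f x \<partial>lborel)"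
  by (subst (2) lborel_distr_plus[of c, symmetric], subst nn_integral_distr) auto

lemma borel_measurable_shift_Re [measurable]: "(\<lambda>z. z + complex_of_real (a * Im z)) \<in> borel_measurable borel"
  by (intro borel_measurable_continuous_onI continuous_intros)

lemma borel_measurable_shift_Im [measurable]: "(\<lambda>z. z + \<i> * complex_of_real (a * Re z)) \<in> borel_measurable borel"
  by (intro borel_measurable_continuous_onI continuous_intros)

text \<open>For a fixed imaginary part the shear is a real translation, so with the inner integral
  taken over the real part translation invariance suffices.\<close>

lemma nn_integral_shear_Re:
  fixes f :: "complex \<Rightarrow> ennreal"
  assumes [measurable]: "f \<in> borel_measurable borel"
  shows "(\<integral>\<^sup>+z. f (z + complex_of_real (a * Im z)) \<partial>lborel) = (\<integral>\<^sup>+z. f z \<partial>lborel)"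
proof -
  have "(\<integral>\<^sup>+x. f (Complex x y + complex_of_real (a * y)) \<partial>lborel) = (\<integral>\<^sup>+x. f (Complex x y) \<partial>lborel)" for y
  proof -
    have [measurable]: "(\<lambda>x. Complex x y) \<in> borel_measurable borel"
      by (intro borel_measurable_continuous_onI continuous_intros)
    have "(\<integral>\<^sup>+x. f (Complex x y + complex_of_real (a * y)) \<partial>lborel)
        = (\<integral>\<^sup>+x. f (Complex (a * y + x) y) \<partial>lborel)"
      by (intro nn_integral_cong arg_cong[where f=f]) (simp add: complex_eq_iff)
    then show ?thesis
      by (simp add: nn_integral_lborel_translate[of "\<lambda>x. f (Complex x y)" "a * y"])
  qed
  then show ?thesis
    by (simp add: nn_integral_complex_Im_Re)
qed

lemma nn_integral_shear_Im:
  fixes f :: "complex \<Rightarrow> ennreal"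
  assumes [measurable]: "f \<in> borel_measurable borel"
  shows "(\<integral>\<^sup>+z. f (z + \<i> * complex_of_real (a * Re z)) \<partial>lborel) = (\<integral>\<^sup>+z. f z \<partial>lborel)"
proof -
  have "(\<integral>\<^sup>+y. f (Complex x y + \<i> * complex_of_real (a * x)) \<partial>lborel) = (\<integral>\<^sup>+y. f (Complex x y) \<partial>lborel)" for x
  proof -
    have [measurable]: "(\<lambda>y. Complex x y) \<in> borel_measurable borel"
      by (intro borel_measurable_continuous_onI continuous_intros)
    have "(\<integral>\<^sup>+y. f (Complex x y + \<i> * complex_of_real (a * x)) \<partial>lborel)
        = (\<integral>\<^sup>+y. f (Complex x (a * x + y)) \<partial>lborel)"
      by (intro nn_integral_cong arg_cong[where f=f]) (simp add: complex_eq_iff)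
    then show ?thesis
      by (simp add: nn_integral_lborel_translate[of "\<lambda>y. f (Complex x y)" "a * x"])
  qed
  then show ?thesis
    by (simp add: nn_integral_complex_Re_Im)
qed

text \<open>A plane rotation other than the half turn is a product of three shears.\<close>

lemma nn_integral_rotate:
  fixes f :: "complex \<Rightarrow> ennreal"
  assumes [measurable]: "f \<in> borel_measurable borel" and \<omega>: "cmod \<omega> = 1"
  shows "(\<integral>\<^sup>+z. f (\<omega> * z) \<partial>lborel) = (\<integral>\<^sup>+z. f z \<partial>lborel)"
proof -
  have rot: "(\<integral>\<^sup>+z. f (\<omega> * z) \<partial>lborel) = (\<integral>\<^sup>+z. f z \<partial>lborel)"
    if \<omega>: "cmod \<omega> = 1" "\<omega> \<noteq> -1" and [measurable]: "f \<in> borel_measurable borel"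
    for \<omega> and f :: "complex \<Rightarrow> ennreal"
  proof -
    \<comment> \<open>For \<open>\<omega> = cis \<theta>\<close> this is
      \<open>- tan (\<theta> / 2)\<close>, the shear parameter for which \<open>X\<close>,
      \<open>Y\<close>, \<open>X\<close> in succession give the rotation. It is undefined exactly at
      the half turn.\<close>
    define a where "a = - Im \<omega> / (1 + Re \<omega>)"
    have sq: "(Re \<omega>)\<^sup>2 + (Im \<omega>)\<^sup>2 = 1"
      using \<omega>(1) by (metis cmod_power2 one_power2)
    have nz: "1 + Re \<omega> \<noteq> 0"
    proof
      assume *: "1 + Re \<omega> = 0"
      then have "Re \<omega> = -1" by simp
      with sq have "Im \<omega> = 0" by simp
      with \<open>Re \<omega> = -1\<close> \<omega>(2) show False by (simp add: complex_eq_iff)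
    qed
    have c1: "1 + a * Im \<omega> = Re \<omega>"
      using nz sq by (simp add: a_def field_simps power2_eq_square)
    have c2: "a + a * Re \<omega> = - Im \<omega>"
      using nz unfolding a_def by (metis (no_types, lifting) distrib_left mult.right_neutral nonzero_eq_divide_eq)
    define X where "X z = z + complex_of_real (a * Im z)" for z
    define Y where "Y z = z + \<i> * complex_of_real (Im \<omega> * Re z)" for z
    have [measurable]: "X \<in> borel_measurable borel" "Y \<in> borel_measurable borel"
      unfolding X_def[abs_def] Y_def[abs_def] by measurable
    have eq: "\<omega> * z = X (Y (X z))" for z
    proof (rule complex_eqI)
      have "Im (X (Y (X z))) = Im z * (1 + a * Im \<omega>) + Im \<omega> * Re z"
        by (simp add: X_def Y_def algebra_simps)
      then show "Im (\<omega> * z) = Im (X (Y (X z)))" by (simp add: c1 algebra_simps)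
      have "Re (X (Y (X z))) = Re z * (1 + a * Im \<omega>) + Im z * (a + a * (1 + a * Im \<omega>))"
        by (simp add: X_def Y_def algebra_simps)
      then show "Re (\<omega> * z) = Re (X (Y (X z)))" unfolding c1 c2 by (simp add: algebra_simps)
    qed
    have "(\<integral>\<^sup>+z. f (X (Y (X z))) \<partial>lborel) = (\<integral>\<^sup>+z. f (X (Y z)) \<partial>lborel)"
      using nn_integral_shear_Re[of "\<lambda>z. f (X (Y z))" a] by (simp add: X_def)
    also have "\<dots> = (\<integral>\<^sup>+z. f (X z) \<partial>lborel)"
      using nn_integral_shear_Im[of "\<lambda>z. f (X z)" "Im \<omega>"] by (simp add: Y_def)
    also have "\<dots> = (\<integral>\<^sup>+z. f z \<partial>lborel)"
      using nn_integral_shear_Re[of f a] by (simp add: X_def)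
    finally show ?thesis by (simp add: eq)
  qed
  show ?thesis
  \<comment> \<open>The half turn is the square of the quarter turn \<open>\<i>\<close>, to which
    \<open>rot\<close> applies.\<close>
  proof (cases "\<omega> = -1")
    case True
    have "\<i> \<noteq> -1" by (simp add: complex_eq_iff)
    then have "(\<integral>\<^sup>+z. f (\<i> * (\<i> * z)) \<partial>lborel) = (\<integral>\<^sup>+z. f z \<partial>lborel)"
      using rot[of \<i> "\<lambda>z. f (\<i> * z)"] rot[of \<i> f] by simp
    then show ?thesis using True by simp
  qed (use rot \<omega> in auto)
qed

lemma distr_lborel_rotate:
  fixes \<omega> :: complex
  assumes "cmod \<omega> = 1"
  shows "distr lborel borel ((*) \<omega>) = lborel"
proof (rule measure_eqI)
  fix A assume "A \<in> sets (distr lborel borel ((*) \<omega>))"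
  then have [measurable]: "A \<in> sets borel" by simp
  have "emeasure (distr lborel borel ((*) \<omega>)) A = (\<integral>\<^sup>+z. indicator A z \<partial>distr lborel borel ((*) \<omega>))"
    by simp
  also have "\<dots> = (\<integral>\<^sup>+z. indicator A (\<omega> * z) \<partial>lborel)"
    by (subst nn_integral_distr) auto
  also have "\<dots> = (\<integral>\<^sup>+z. indicator A z \<partial>lborel)"
    using assms by (intro nn_integral_rotate) auto
  also have "\<dots> = emeasure lborel A" by simp
  finally show "emeasure (distr lborel borel ((*) \<omega>)) A = emeasure lborel A" .
qed simp

section \<open>Gaussian integrals and integrability of the decay term\<close>

lemma nn_integral_gaussian_real:
  assumes "c > 0"
  shows "(\<integral>\<^sup>+x. ennreal (exp (- c * x\<^sup>2)) \<partial>lborel) = ennreal (sqrt (pi / c))"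
proof -
  \<comment> \<open>The standard deviation for which the normal density is a multiple of the given
    Gaussian.\<close>
  define \<sigma> where "\<sigma> = sqrt (1 / (2 * c))"
  have \<sigma>: "\<sigma> > 0" "2 * \<sigma>\<^sup>2 = 1 / c" using assms by (auto simp: \<sigma>_def field_simps)
  have "exp (- c * x\<^sup>2) = sqrt (pi / c) * normal_density 0 \<sigma> x" for x
  proof -
    have "2 * pi * \<sigma>\<^sup>2 = pi / c" using \<sigma>(2) by (simp add: field_simps)
    moreover have "- (x - 0)\<^sup>2 / (2 * \<sigma>\<^sup>2) = - c * x\<^sup>2" using \<sigma>(2) by simp
    ultimately show ?thesis
      using assms by (simp add: normal_density_def)
  qed
  then have "(\<integral>\<^sup>+x. ennreal (exp (- c * x\<^sup>2)) \<partial>lborel)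
      = (\<integral>\<^sup>+x. ennreal (sqrt (pi / c)) * ennreal (normal_density 0 \<sigma> x) \<partial>lborel)"
    using assms by (simp add: ennreal_mult)
  also have "\<dots> = ennreal (sqrt (pi / c)) * (\<integral>\<^sup>+x. ennreal (normal_density 0 \<sigma> x) \<partial>lborel)"
    by (rule nn_integral_cmult) simp
  also have "(\<integral>\<^sup>+x. ennreal (normal_density 0 \<sigma> x) \<partial>lborel) = 1"
    using prob_space.emeasure_space_1[OF prob_space_normal_density[OF \<sigma>(1), of 0]]
    by (simp add: emeasure_density)
  finally show ?thesis by simp
qed

lemma nn_integral_gaussian_complex:
  assumes c: "c > 0"
  shows "(\<integral>\<^sup>+z. ennreal (exp (- c * (cmod z)\<^sup>2)) \<partial>lborel) = ennreal (pi / c)"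
proof -
  have "(\<integral>\<^sup>+z. ennreal (exp (- c * (cmod z)\<^sup>2)) \<partial>lborel)
      = (\<integral>\<^sup>+x. \<integral>\<^sup>+y. ennreal (exp (- c * x\<^sup>2)) * ennreal (exp (- c * y\<^sup>2)) \<partial>lborel \<partial>lborel)"
    by (subst nn_integral_complex_Re_Im)
       (auto simp: cmod_power2 ennreal_mult[symmetric] exp_add[symmetric] algebra_simps)
  also have "\<dots> = ennreal (sqrt (pi / c)) * ennreal (sqrt (pi / c))"
    using c nn_integral_gaussian_real[OF c] by (simp add: nn_integral_cmult nn_integral_multc)
  also have "\<dots> = ennreal (pi / c)" using c by (simp add: ennreal_mult[symmetric])
  finally show ?thesis .
qed

lemma nn_integral_inverse_1_plus_square_finite:
  "(\<integral>\<^sup>+x. ennreal (1 / (1 + x\<^sup>2)) \<partial>lborel) < \<infinity>"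
proof -
  have "integrable lborel (\<lambda>x::real. 1 / (1 + x\<^sup>2))"
    using integrable_inverse_1_plus_square
    by (simp add: set_integrable_def divide_inverse)
  then show ?thesis
    by (simp add: integrable_iff_bounded)
qed

text \<open>The fourth power splits into two squares, one dominating \<open>1 + (Re z)^2\<close> and
  the other \<open>1 + (Im z)^2\<close>, so the integral is bounded by a product of two convergent
  real integrals.\<close>

lemma nn_integral_decay_finite:
  "(\<integral>\<^sup>+z. ennreal ((exp 1 + cmod z) powr (-4)) \<partial>lborel) < \<infinity>"
proof -
  have le: "(exp 1 + cmod z) powr (-4) \<le> (1 / (1 + (Re z)\<^sup>2)) * (1 / (1 + (Im z)\<^sup>2))" for z
  proof -
    have "1 + (Re z)\<^sup>2 \<le> (exp 1 + cmod z)\<^sup>2" "1 + (Im z)\<^sup>2 \<le> (exp 1 + cmod z)\<^sup>2"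
    proof -
      have "(1::real) \<le> (exp 1)\<^sup>2" by simp
      moreover have "(Re z)\<^sup>2 \<le> (cmod z)\<^sup>2" "(Im z)\<^sup>2 \<le> (cmod z)\<^sup>2" by (simp_all add: cmod_power2)
      ultimately show "1 + (Re z)\<^sup>2 \<le> (exp 1 + cmod z)\<^sup>2" "1 + (Im z)\<^sup>2 \<le> (exp 1 + cmod z)\<^sup>2"
        by (simp_all add: power2_sum add_increasing2 add_mono)
    qed
    then have "(1 + (Re z)\<^sup>2) * (1 + (Im z)\<^sup>2) \<le> (exp 1 + cmod z)\<^sup>2 * (exp 1 + cmod z)\<^sup>2"
      by (intro mult_mono) auto
    also have "\<dots> = (exp 1 + cmod z) ^ 4" by (simp add: power_add[symmetric])
    finally have "(1 + (Re z)\<^sup>2) * (1 + (Im z)\<^sup>2) \<le> (exp 1 + cmod z) ^ 4" .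
    moreover have "(exp 1 + cmod z) powr (-4) = 1 / (exp 1 + cmod z) ^ 4"
      by (subst powr_minus_divide) (simp add: powr_numeral add_pos_nonneg)
    moreover have "0 < (1 + (Re z)\<^sup>2) * (1 + (Im z)\<^sup>2)"
      by (intro mult_pos_pos add_pos_nonneg) auto
    ultimately show ?thesis
      by (simp add: frac_le)
  qed
  have "(\<integral>\<^sup>+z. ennreal ((exp 1 + cmod z) powr (-4)) \<partial>lborel)
      \<le> (\<integral>\<^sup>+z. ennreal ((1 / (1 + (Re z)\<^sup>2)) * (1 / (1 + (Im z)\<^sup>2))) \<partial>lborel)"
    by (intro nn_integral_mono ennreal_leI le)
  also have "\<dots> = (\<integral>\<^sup>+x. \<integral>\<^sup>+y. ennreal (1 / (1 + x\<^sup>2)) * ennreal (1 / (1 + y\<^sup>2)) \<partial>lborel \<partial>lborel)"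
    by (subst nn_integral_complex_Re_Im) (auto simp: ennreal_mult'[symmetric])
  also have "\<dots> = (\<integral>\<^sup>+x. ennreal (1 / (1 + x\<^sup>2)) \<partial>lborel) * (\<integral>\<^sup>+x. ennreal (1 / (1 + x\<^sup>2)) \<partial>lborel)"
    by (simp add: nn_integral_cmult nn_integral_multc)
  also have "\<dots> < \<infinity>"
    using nn_integral_inverse_1_plus_square_finite by (simp add: ennreal_mult_less_top)
  finally show ?thesis .
qed

section \<open>The reproducing formula\<close>

text \<open>The bound on \<open>k\<close> is asked only where \<open>g\<close> is nonzero; this is
  how compact support of \<open>g\<close> enters. The terms are then dominated by
  \<open>cmod (g w)\<close> times a convergent numerical series. The mean value property, the
  expansion of the projection and the pairing with \<open>rep\<close> all use this.\<close>

lemma sums_integral_power_series: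
  fixes g k :: "'a \<Rightarrow> complex" and a :: "nat \<Rightarrow> complex"
  assumes g: "integrable M g" and [measurable]: "k \<in> borel_measurable M"
    and kR: "\<And>w. g w \<noteq> 0 \<Longrightarrow> cmod (k w) \<le> R"
    and sm: "summable (\<lambda>n. cmod (a n) * R ^ n)"
  shows "(\<lambda>n. a n * (\<integral>w. g w * k w ^ n \<partial>M)) sums (\<integral>w. g w * (\<Sum>n. a n * k w ^ n) \<partial>M)"
proof -
  have [measurable]: "g \<in> borel_measurable M" using g by auto
  have b: "cmod (g w * k w ^ n) \<le> cmod (g w) * R ^ n" for w n
    using kR[of w] by (cases "g w = 0") (auto simp: norm_mult norm_power intro!: mult_left_mono power_mono)
  have int: "integrable M (\<lambda>w. g w * k w ^ n)" for n
    by (rule Bochner_Integration.integrable_bound[of M "\<lambda>w. cmod (g w) * R ^ n"])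
       (use g in \<open>auto intro!: AE_I2 order_trans[OF b] abs_ge_self\<close>)
  have b2: "cmod (a n * (g w * k w ^ n)) \<le> cmod (g w) * (cmod (a n) * R ^ n)" for n w
    using mult_left_mono[OF b, of "cmod (a n)" w n] by (simp add: norm_mult mult_ac)
  have sm1: "summable (\<lambda>n. cmod (a n * (g w * k w ^ n)))" for w
    by (rule summable_comparison_test'[OF summable_mult[OF sm, of "cmod (g w)"], of 0]) (use b2 in auto)
  have sm2: "summable (\<lambda>n. (\<integral>w. cmod (a n * (g w * k w ^ n)) \<partial>M))"
  proof (rule summable_comparison_test'[of "\<lambda>n. (\<integral>w. cmod (g w) \<partial>M) * (cmod (a n) * R ^ n)" 0])
    show "summable (\<lambda>n. (\<integral>w. cmod (g w) \<partial>M) * (cmod (a n) * R ^ n))"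
      by (intro summable_mult sm)
    fix n :: nat
    have "(\<integral>w. cmod (a n * (g w * k w ^ n)) \<partial>M) \<le> (\<integral>w. cmod (g w) * (cmod (a n) * R ^ n) \<partial>M)"
      using int b2 g by (intro integral_mono) auto
    then show "norm (\<integral>w. cmod (a n * (g w * k w ^ n)) \<partial>M) \<le> (\<integral>w. cmod (g w) \<partial>M) * (cmod (a n) * R ^ n)"
      by simp
  qed
  have "(\<lambda>n. (\<integral>w. a n * (g w * k w ^ n) \<partial>M)) sums (\<integral>w. (\<Sum>n. a n * (g w * k w ^ n)) \<partial>M)"
    by (rule sums_integral) (use int sm1 sm2 in auto)
  moreover have "(\<Sum>n. a n * (g w * k w ^ n)) = g w * (\<Sum>n. a n * k w ^ n)" for w
  \<comment> \<open>Where \<open>g\<close> vanishes the series in \<open>k w\<close> may diverge,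
    but both sides are 0. Elsewhere its summability follows by cancelling
    \<open>g w\<close>.\<close>
  proof (cases "g w = 0")
    case False
    have "summable (\<lambda>n. g w * (a n * k w ^ n))"
      using summable_norm_cancel[OF sm1[of w]] by (simp add: mult_ac)
    then have "summable (\<lambda>n. a n * k w ^ n)"
      using False by (simp add: summable_cmult_iff)
    from suminf_mult[OF this, of "g w"] show ?thesis by (simp add: mult_ac)
  qed simp
  ultimately show ?thesis by simp
qed

text \<open>Rotation by the angle \<open>pi / n\<close> preserves the measure and the radial factor
  and changes the sign of \<open>z ^ n\<close>, so the integral equals its own negative.\<close>

lemma integral_power_radial_eq_0:
  fixes \<phi> :: "real \<Rightarrow> real"
  assumes [measurable]: "\<phi> \<in> borel_measurable borel" and n: "n > 0"
  shows "(\<integral>z. complex_of_real (\<phi> (cmod z)) * z ^ n \<partial>lborel) = 0" (is "?I = 0")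
proof -
  define \<omega> where "\<omega> = cis (pi / n)"
  have \<omega>n: "\<omega> ^ n = -1" using n by (simp add: \<omega>_def Complex.DeMoivre)
  have "?I = (\<integral>z. complex_of_real (\<phi> (cmod z)) * z ^ n \<partial>distr lborel borel ((*) \<omega>))"
    by (subst distr_lborel_rotate) (simp_all add: \<omega>_def)
  also have "\<dots> = (\<integral>z. complex_of_real (\<phi> (cmod (\<omega> * z))) * (\<omega> * z) ^ n \<partial>lborel)"
    by (rule integral_distr) auto
  also have "\<dots> = (\<integral>z. - (complex_of_real (\<phi> (cmod z)) * z ^ n) \<partial>lborel)"
    by (simp add: power_mult_distrib \<omega>n norm_mult) (simp add: \<omega>_def)
  also have "\<dots> = - ?I" by simp
  finally show ?thesis by simp
qed

lemma integrable_gaussian_complex: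
  assumes "c > 0"
  shows "integrable lborel (\<lambda>z. exp (- c * (cmod z)\<^sup>2))"
    and "(\<integral>z. exp (- c * (cmod z)\<^sup>2) \<partial>lborel) = pi / c"
  using nn_integral_gaussian_complex[OF assms] assms
  by (auto simp: integrable_iff_bounded integral_eq_nn_integral)

text \<open>The cutoff at radius \<open>R\<close> makes the Taylor series of \<open>F\<close>
  dominated, so it may be integrated termwise. All terms but the constant one vanish by
  rotation.\<close>

lemma gaussian_mean_value_ball:
  assumes F: "F holomorphic_on UNIV" and R: "R > 0"
  defines "\<phi> \<equiv> \<lambda>r::real. indicator {..R} r * exp (- 2 * r\<^sup>2)"
  shows "(\<integral>z. complex_of_real (\<phi> (cmod z)) * F z \<partial>lborel) = F 0 * (\<integral>z. complex_of_real (\<phi> (cmod z)) \<partial>lborel)"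
proof -
  define a where "a n = (deriv ^^ n) F 0 / fact n" for n
  have ps: "(\<lambda>n. a n * z ^ n) sums F z" for z
    using holomorphic_power_series[of F 0 "cmod z + 1" z] holomorphic_on_subset[OF F]
    by (simp add: a_def)
  have [measurable]: "\<phi> \<in> borel_measurable borel" unfolding \<phi>_def by measurable
  have int: "integrable lborel (\<lambda>z. complex_of_real (\<phi> (cmod z)))"
    by (rule Bochner_Integration.integrable_bound[OF integrable_gaussian_complex(1)[of 2]])
       (auto simp: \<phi>_def norm_mult indicator_def)
  have sm: "summable (\<lambda>n. cmod (a n) * R ^ n)"
  proof -
    \<comment> \<open>Absolute convergence at radius \<open>R\<close> follows from convergence at a
      point of strictly larger modulus, here \<open>R + 1\<close>.\<close>
    have "summable (\<lambda>n. cmod (a n * complex_of_real R ^ n))"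
      by (rule powser_insidea[of _ "complex_of_real (R + 1)"]) (use ps R in \<open>auto simp: sums_iff\<close>)
    then show ?thesis using R by (simp add: norm_mult norm_power)
  qed
  have "(\<lambda>n. a n * (\<integral>z. complex_of_real (\<phi> (cmod z)) * z ^ n \<partial>lborel)) sums
        (\<integral>z. complex_of_real (\<phi> (cmod z)) * (\<Sum>n. a n * z ^ n) \<partial>lborel)"
    by (rule sums_integral_power_series[where R = R]) (use int sm in \<open>auto simp: \<phi>_def indicator_def\<close>)
  also have "(\<lambda>z. \<Sum>n. a n * z ^ n) = F"
    using ps by (auto simp: sums_iff)
  finally have "(\<lambda>n. a n * (\<integral>z. complex_of_real (\<phi> (cmod z)) * z ^ n \<partial>lborel)) sums
        (\<integral>z. complex_of_real (\<phi> (cmod z)) * F z \<partial>lborel)" by (simp add: fun_eq_iff)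
  moreover have "(\<lambda>n. a n * (\<integral>z. complex_of_real (\<phi> (cmod z)) * z ^ n \<partial>lborel)) sums
        (a 0 * (\<integral>z. complex_of_real (\<phi> (cmod z)) * z ^ 0 \<partial>lborel))"
    using integral_power_radial_eq_0[of \<phi>] 
    by (intro sums_single[of 0 "\<lambda>n. a n * (\<integral>z. complex_of_real (\<phi> (cmod z)) * z ^ n \<partial>lborel)", THEN sums_cong[THEN iffD1, rotated]]) auto
  ultimately show ?thesis by (auto simp: a_def dest: sums_unique2)
qed

lemma gaussian_mean_value:
  assumes F: "F holomorphic_on UNIV"
    and int: "integrable lborel (\<lambda>z. complex_of_real (exp (- 2 * (cmod z)\<^sup>2)) * F z)"
  shows "(\<integral>z. complex_of_real (exp (- 2 * (cmod z)\<^sup>2)) * F z \<partial>lborel) = of_real (pi / 2) * F 0"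
proof -
  \<comment> \<open>\<open>Suc n\<close> keeps the cutoff radii positive, as the lemma on balls
    demands. The limit is taken for a general \<open>G\<close> because it is used for
    \<open>F\<close> and for the constant 1.\<close>
  have cut: "(\<lambda>n. \<integral>z. complex_of_real (indicator {..real (Suc n)} (cmod z) * exp (- 2 * (cmod z)\<^sup>2)) * G z \<partial>lborel)
      \<longlonglongrightarrow> (\<integral>z. complex_of_real (exp (- 2 * (cmod z)\<^sup>2)) * G z \<partial>lborel)"
    if G: "integrable lborel (\<lambda>z. complex_of_real (exp (- 2 * (cmod z)\<^sup>2)) * G z)" and [measurable]: "G \<in> borel_measurable borel"
    for G
  proof (rule integral_dominated_convergence[OF _ _ integrable_norm[OF G]])
    show "AE z in lborel. (\<lambda>n. complex_of_real (indicator {..real (Suc n)} (cmod z) * exp (- 2 * (cmod z)\<^sup>2)) * G z)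
        \<longlonglongrightarrow> complex_of_real (exp (- 2 * (cmod z)\<^sup>2)) * G z"
    proof (rule AE_I2, rule tendsto_eventually)
      fix z :: complex
      show "\<forall>\<^sub>F n in sequentially. complex_of_real (indicator {..real (Suc n)} (cmod z) * exp (- 2 * (cmod z)\<^sup>2)) * G z
          = complex_of_real (exp (- 2 * (cmod z)\<^sup>2)) * G z"
        using eventually_ge_at_top[of "nat \<lceil>cmod z\<rceil>"]
      proof eventually_elim
        case (elim n)
        then have "cmod z \<le> real (Suc n)" by linarith
        then show ?case by simp
      qed
    qed
  qed (auto simp: norm_mult indicator_def)
  have [measurable]: "F \<in> borel_measurable borel"
    using F by (intro borel_measurable_continuous_onI holomorphic_on_imp_continuous_on)
  have g: "integrable lborel (\<lambda>z. complex_of_real (exp (- 2 * (cmod z)\<^sup>2)) * 1)"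
    using integrable_gaussian_complex(1)[of 2] by (simp only: mult_1_right integrable_of_real)
  have "(\<lambda>n. F 0 * (\<integral>z. complex_of_real (indicator {..real (Suc n)} (cmod z) * exp (- 2 * (cmod z)\<^sup>2)) * 1 \<partial>lborel))
      \<longlonglongrightarrow> F 0 * (\<integral>z. complex_of_real (exp (- 2 * (cmod z)\<^sup>2)) * 1 \<partial>lborel)"
    by (intro tendsto_mult_left cut g) auto
  moreover have "F 0 * (\<integral>z. complex_of_real (exp (- 2 * (cmod z)\<^sup>2)) * 1 \<partial>lborel) = of_real (pi / 2) * F 0"
    by (simp only: mult_1_right integral_complex_of_real integrable_gaussian_complex(2)[OF zero_less_numeral])
       (rule mult.commute)
  moreover have "F 0 * (\<integral>z. complex_of_real (indicator {..real (Suc n)} (cmod z) * exp (- 2 * (cmod z)\<^sup>2)) * 1 \<partial>lborel)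
      = (\<integral>z. complex_of_real (indicator {..real (Suc n)} (cmod z) * exp (- 2 * (cmod z)\<^sup>2)) * F z \<partial>lborel)" for n
    using gaussian_mean_value_ball[OF F, of "real (Suc n)"] by simp
  ultimately have "(\<lambda>n. \<integral>z. complex_of_real (indicator {..real (Suc n)} (cmod z) * exp (- 2 * (cmod z)\<^sup>2)) * F z \<partial>lborel)
      \<longlonglongrightarrow> of_real (pi / 2) * F 0"
    by (simp only:)
  with cut[OF int] show ?thesis by (intro LIMSEQ_unique) auto
qed

text \<open>Substituting \<open>w = z + v\<close> turns the exponent
  \<open>2 * z * cnj w - 2 * w * cnj w\<close> into \<open>- 2 * cnj z * v - 2 * v * cnj v\<close>.
  The first summand is holomorphic in \<open>v\<close>, so the integral is a Gaussian mean of the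
  entire function \<open>F\<close>, with value \<open>F 0 = f z\<close>.\<close>

lemma fock_reproducing:
  assumes f: "f holomorphic_on UNIV"
    and int: "integrable lborel (\<lambda>w. f w * exp (2 * z * cnj w) * complex_of_real (exp (- 2 * (cmod w)\<^sup>2)))"
  shows "complex_of_real (2 / pi) * (\<integral>w. f w * exp (2 * z * cnj w) * complex_of_real (exp (- 2 * (cmod w)\<^sup>2)) \<partial>lborel) = f z"
proof -
  let ?G = "\<lambda>w. f w * exp (2 * z * cnj w) * complex_of_real (exp (- 2 * (cmod w)\<^sup>2))"
  define F where "F v = f (z + v) * exp (- 2 * cnj z * v)" for v
  have [measurable]: "f \<in> borel_measurable borel"
    using f by (intro borel_measurable_continuous_onI holomorphic_on_imp_continuous_on)
  have [measurable]: "(\<lambda>w. exp (2 * z * cnj w)) \<in> borel_measurable borel"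
    by (intro borel_measurable_continuous_onI continuous_intros)
  have F: "F holomorphic_on UNIV"
    unfolding F_def by (intro holomorphic_intros holomorphic_on_compose_gen[OF _ f, unfolded o_def]) auto
  have eq: "?G (z + v) = complex_of_real (exp (- 2 * (cmod v)\<^sup>2)) * F v" for v
  proof -
    have e: "complex_of_real (exp (- 2 * (cmod w)\<^sup>2)) = exp (- 2 * w * cnj w)" for w
      by (simp add: exp_of_real[symmetric] complex_norm_square[simplified] mult.assoc del: exp_of_real)
    show ?thesis
      unfolding e F_def by (simp add: exp_add[symmetric] algebra_simps)
  qed
  have int': "integrable lborel (\<lambda>v. ?G (z + v))"
    by (rule integrable_distr[of "(+) z" lborel borel]) (use int in \<open>auto simp: lborel_distr_plus\<close>)
  have "(\<integral>w. ?G w \<partial>lborel) = (\<integral>w. ?G w \<partial>distr lborel borel ((+) z))"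
    by (simp add: lborel_distr_plus)
  also have "\<dots> = (\<integral>v. ?G (z + v) \<partial>lborel)"
    by (rule integral_distr) auto
  also have "\<dots> = of_real (pi / 2) * F 0"
    unfolding eq using int' unfolding eq by (rule gaussian_mean_value[OF F])
  finally show ?thesis by (simp add: F_def field_simps)
qed

section \<open>Gaussian averages in variable exponent Lebesgue spaces\<close>

text \<open>Jensen's inequality for a power. Young's inequality with second factor
  \<open>s powr (r - 1)\<close>, where \<open>s\<close> is the mean, says that the power function
  lies above its tangent at \<open>s\<close>; integrating gives the claim.\<close>

lemma (in prob_space) powr_expectation_le:
  fixes u :: "'a \<Rightarrow> real"
  assumes u: "integrable M u" "integrable M (\<lambda>x. u x powr r)" "\<And>x. 0 \<le> u x" and r: "1 \<le> r"
  shows "expectation u powr r \<le> expectation (\<lambda>x. u x powr r)"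
proof (cases "r = 1")
  case True
  then show ?thesis using u by simp
next
  case False
  define s where "s = expectation u"
  have s: "0 \<le> s" using u by (simp add: s_def)
  have r1: "r > 1" using False r by simp
  define q where "q = r / (r - 1)"
  have q: "q > 1" "1 / r + 1 / q = 1" "(r - 1) * q = r"
    using r1 by (auto simp: q_def field_simps)
  have "u x * s powr (r - 1) \<le> u x powr r / r + s powr r / q" for x
    using Youngs_inequality[OF r1 q(1,2), of "u x" "s powr (r - 1)"] u(3) by (simp add: powr_powr q(3))
  then have "expectation (\<lambda>x. u x * s powr (r - 1)) \<le> expectation (\<lambda>x. u x powr r / r + s powr r / q)"
    using u by (intro integral_mono) auto
  also have "\<dots> = expectation (\<lambda>x. u x powr r) / r + s powr r / q"
    using u by (simp add: prob_space)
  also have "expectation (\<lambda>x. u x * s powr (r - 1)) = s powr r"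
    using s r1 by (cases "s = 0") (auto simp: s_def[symmetric] powr_mult_base)
  finally have "s powr r * (1 / r + 1 / q) \<le> expectation (\<lambda>x. u x powr r) / r + s powr r / q"
    unfolding q(2) by simp
  then have "s powr r / r \<le> expectation (\<lambda>x. u x powr r) / r"
    by (simp add: algebra_simps)
  then show ?thesis using r1 by (simp add: s_def divide_le_cancel)
qed

text \<open>Either \<open>t\<close> lies below the decay term, and then so does
  \<open>t powr q\<close>, or \<open>- ln t\<close> is at most \<open>4 * ln (exp 1 + x)\<close>,
  and then the bound on \<open>q - r\<close> cancels the logarithm and leaves the factor
  \<open>exp (4 * C)\<close>. The exponent 4 is the one that makes the error integrable over the
  plane.\<close>

lemma powr_le_powr_add_decay:
  fixes t q r C x :: real
  assumes t: "0 \<le> t" "t \<le> 1" and q: "1 \<le> q" and x: "0 \<le> x"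
    and qr: "\<bar>q - r\<bar> \<le> C / ln (exp 1 + x)"
  shows "t powr q \<le> exp (4 * C) * t powr r + (exp 1 + x) powr (-4)"
proof (cases "t \<le> (exp 1 + x) powr (-4)")
  case True
  have "t powr q \<le> t powr 1"
    using t q by (intro powr_mono') auto
  also have "\<dots> \<le> (exp 1 + x) powr (-4)" using True t by simp
  finally show ?thesis by (simp add: add_increasing)
next
  case False
  have e: "0 < exp 1 + x" using x by (simp add: add_pos_nonneg)
  have l: "0 < ln (exp 1 + x)"
    using x by (intro ln_gt_zero) (use exp_ge_add_one_self[of 1] in linarith)
  have t0: "0 < t" using False t powr_ge_zero[of "exp 1 + x" "-4"] by linarith
  have "- ln t \<le> 4 * ln (exp 1 + x)"
  proof -
    have "ln ((exp 1 + x) powr (-4)) \<le> ln t"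
      using False t0 e by (subst ln_le_cancel_iff) auto
    then show ?thesis by (simp add: ln_powr)
  qed
  then have "(q - r) * ln t \<le> \<bar>q - r\<bar> * (4 * ln (exp 1 + x))"
    using t t0 by (smt (verit, best) abs_ge_minus_self abs_ge_zero ln_le_zero_iff mult_left_mono mult_minus_left mult_minus_right mult_right_mono_neg)
  also have "\<dots> \<le> C / ln (exp 1 + x) * (4 * ln (exp 1 + x))"
    using qr l by (intro mult_right_mono) auto
  also have "\<dots> = 4 * C" using l by simp
  finally have "t powr (q - r) \<le> exp (4 * C)"
    using t0 by (simp add: powr_def)
  then have "t powr r * t powr (q - r) \<le> exp (4 * C) * t powr r"
    by (subst mult.commute, intro mult_right_mono) auto
  moreover have "t powr q = t powr r * t powr (q - r)"
    by (simp add: powr_add[symmetric])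
  moreover have "0 \<le> (exp 1 + x) powr (-4)" by simp
  ultimately show ?thesis by linarith
qed

lemma
  shows nn_integral_gaussian_kernel_right: "(\<integral>\<^sup>+w. ennreal (exp (- (cmod (z - w))\<^sup>2)) \<partial>lborel) = ennreal pi"
    and nn_integral_gaussian_kernel_left: "(\<integral>\<^sup>+w. ennreal (exp (- (cmod (w - z))\<^sup>2)) \<partial>lborel) = ennreal pi"
proof -
  show *: "(\<integral>\<^sup>+w. ennreal (exp (- (cmod (w - z))\<^sup>2)) \<partial>lborel) = ennreal pi"
    using nn_integral_lborel_translate[of "\<lambda>w. ennreal (exp (- (cmod (w - z))\<^sup>2))" z]
      nn_integral_gaussian_complex[of 1] by simp
  show "(\<integral>\<^sup>+w. ennreal (exp (- (cmod (z - w))\<^sup>2)) \<partial>lborel) = ennreal pi"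
    using * by (simp add: norm_minus_commute)
qed

lemma nn_integral_gaussian_average:
  assumes [measurable]: "u \<in> borel_measurable borel"
  shows "(\<integral>\<^sup>+z. \<integral>\<^sup>+w. ennreal (exp (- (cmod (z - w))\<^sup>2)) * u w \<partial>lborel \<partial>lborel) = ennreal pi * (\<integral>\<^sup>+w. u w \<partial>lborel)"
proof -
  have "(\<integral>\<^sup>+z. \<integral>\<^sup>+w. ennreal (exp (- (cmod (z - w))\<^sup>2)) * u w \<partial>lborel \<partial>lborel)
      = (\<integral>\<^sup>+w. \<integral>\<^sup>+z. ennreal (exp (- (cmod (z - w))\<^sup>2)) * u w \<partial>lborel \<partial>lborel)"
    by (rule lborel_pair.Fubini') measurable
  also have "\<dots> = (\<integral>\<^sup>+w. ennreal pi * u w \<partial>lborel)"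
    by (simp add: nn_integral_multc nn_integral_gaussian_kernel_left)
  finally show ?thesis by (simp add: nn_integral_cmult)
qed

text \<open>The kernel has total mass \<open>pi\<close>, so after division by \<open>pi\<close> it
  is a probability density. The bounds on \<open>u\<close> supply the integrability that Jensen's
  inequality asks for.\<close>

lemma gaussian_average_powr_le:
  assumes [measurable]: "u \<in> borel_measurable borel" and u: "\<And>w. 0 \<le> u w" "\<And>w. u w \<le> 1" and r: "1 \<le> r"
    and t: "0 \<le> t" "ennreal t = (\<integral>\<^sup>+w. ennreal (exp (- (cmod (z - w))\<^sup>2)) * ennreal (u w) \<partial>lborel)"
  shows "ennreal ((t / pi) powr r)
    \<le> ennreal (1 / pi) * (\<integral>\<^sup>+w. ennreal (exp (- (cmod (z - w))\<^sup>2)) * ennreal (u w powr r) \<partial>lborel)"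
proof -
  define M where "M = density lborel (\<lambda>w. ennreal (1 / pi) * ennreal (exp (- (cmod (z - w))\<^sup>2)))"
  have nn: "(\<integral>\<^sup>+w. ennreal (v w) \<partial>M) = ennreal (1 / pi) * (\<integral>\<^sup>+w. ennreal (exp (- (cmod (z - w))\<^sup>2)) * ennreal (v w) \<partial>lborel)"
    if [measurable]: "v \<in> borel_measurable borel" for v
    unfolding M_def by (subst nn_integral_density) (auto simp: nn_integral_cmult mult.assoc)
  have "emeasure M (space M) = 1"
    using nn[of "\<lambda>_. 1"] by (simp add: nn_integral_gaussian_kernel_right ennreal_mult[symmetric])
  then interpret M: prob_space M by (rule prob_spaceI)
  have sM [measurable_cong]: "sets M = sets borel" by (simp add: M_def)
  have i1: "integrable M u"
    by (rule M.integrable_const_bound[of _ 1]) (use u in auto)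
  have i2: "integrable M (\<lambda>w. u w powr r)"
    by (rule M.integrable_const_bound[of _ 1]) (use u r in \<open>auto intro!: powr_le1\<close>)
  have "ennreal (t / pi) = ennreal (1 / pi) * ennreal t" using t(1) by (simp add: ennreal_mult[symmetric])
  also have "\<dots> = (\<integral>\<^sup>+w. ennreal (u w) \<partial>M)" unfolding t(2) by (simp add: nn)
  also have "\<dots> = ennreal (M.expectation u)"
    using i1 u by (simp add: nn_integral_eq_integral)
  finally have eq: "t / pi = M.expectation u"
    using t u by (subst (asm) ennreal_inj) (auto intro!: Bochner_Integration.integral_nonneg)
  have "ennreal ((t / pi) powr r) \<le> ennreal (M.expectation (\<lambda>w. u w powr r))"
    unfolding eq using M.powr_expectation_le[OF i1 i2 u(1) r] by (rule ennreal_leI)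
  also have "\<dots> = (\<integral>\<^sup>+w. ennreal (u w powr r) \<partial>M)"
    using i2 by (simp add: nn_integral_eq_integral)
  finally show ?thesis by (simp add: nn)
qed

text \<open>Collects what \<open>p\<close> and its conjugate exponent have in common, so that the
  facts on modular, norm and Fock space apply to both.\<close>

locale bounded_exponent =
  fixes p :: "complex \<Rightarrow> real" and b :: real
  assumes p_measurable [measurable]: "p \<in> borel_measurable borel"
    and p_ge_1: "\<And>z. 1 \<le> p z" and p_le_b: "\<And>z. p z \<le> b"

locale log_exponent = bounded_exponent +
  fixes a pinf C :: real
  assumes a_gt_1: "1 < a" and a_le_p: "\<And>z. a \<le> p z"
    and pinf_ge_1: "1 \<le> pinf"
    and p_decay: "\<And>z. \<bar>p z - pinf\<bar> \<le> C / ln (exp 1 + cmod z)"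
begin

text \<open>Stated for any \<open>v\<close> below the average of \<open>u\<close>, since
  \<open>fock_proj\<close> is merely dominated by such an average. The constant works for all
  \<open>u\<close> and \<open>v\<close> at once.\<close>

lemma gaussian_average_modular_bounded:
  obtains B where "B \<ge> 1"
    "\<And>u v. u \<in> borel_measurable borel \<Longrightarrow> (\<And>w. 0 \<le> u w) \<Longrightarrow>
       (\<integral>\<^sup>+w. ennreal (u w powr p w) \<partial>lborel) \<le> 1 \<Longrightarrow> (\<And>z. 0 \<le> v z) \<Longrightarrow>
       (\<And>z. ennreal (v z) \<le> (\<integral>\<^sup>+w. ennreal (exp (- (cmod (z - w))\<^sup>2)) * ennreal (u w) \<partial>lborel)) \<Longrightarrow>
       (\<integral>\<^sup>+z. ennreal ((v z / B) powr p z) \<partial>lborel) \<le> 1"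
proof -
  define E where "E = enn2real (\<integral>\<^sup>+z. ennreal ((exp 1 + cmod z) powr (-4)) \<partial>lborel)"
  have E: "0 \<le> E" "(\<integral>\<^sup>+z. ennreal ((exp 1 + cmod z) powr (-4)) \<partial>lborel) = ennreal E"
    using nn_integral_decay_finite by (auto simp: E_def)
  \<comment> \<open>The 1 accounts for the large part \<open>l\<close>. The rest accounts for the
    small part \<open>s\<close>, whose exponent is changed twice, each time at the cost of a factor
    \<open>exp (4 * C)\<close> and an additive \<open>E\<close>.\<close>
  define D where "D = 1 + (exp (4 * C) * (exp (4 * C) + E) + E)"
  have D: "D \<ge> 1" using E by (auto simp: D_def intro!: add_nonneg_nonneg mult_nonneg_nonneg)
  have "(\<integral>\<^sup>+z. ennreal ((v z / (2 * pi * D)) powr p z) \<partial>lborel) \<le> 1"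
    if [measurable]: "u \<in> borel_measurable borel" and u0: "\<And>w. 0 \<le> u w"
      and u1: "(\<integral>\<^sup>+w. ennreal (u w powr p w) \<partial>lborel) \<le> 1" and v0: "\<And>z. 0 \<le> v z"
      and v: "\<And>z. ennreal (v z) \<le> (\<integral>\<^sup>+w. ennreal (exp (- (cmod (z - w))\<^sup>2)) * ennreal (u w) \<partial>lborel)"
    for u v
  proof -
    let ?T = "\<lambda>u z. \<integral>\<^sup>+w. ennreal (exp (- (cmod (z - w))\<^sup>2)) * ennreal (u w) \<partial>lborel"
    define s l where "s w = (if u w \<le> 1 then u w else 0)" and "l w = (if u w \<le> 1 then 0 else u w)" for w
    have [measurable]: "s \<in> borel_measurable borel" "l \<in> borel_measurable borel"
      unfolding s_def l_def by measurable
    have s: "0 \<le> s w" "s w \<le> 1" "s w \<le> u w" for w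
      using u0 by (auto simp: s_def)
    have ll: "l w \<le> u w powr p w" for w
    proof (cases "u w \<le> 1")
      case False
      then have "u w powr 1 \<le> u w powr p w" using p_ge_1 by (intro powr_mono) auto
      then show ?thesis using False by (simp add: l_def)
    qed (simp add: l_def)
    have intl: "(\<integral>\<^sup>+w. ennreal (l w) \<partial>lborel) \<le> 1"
      using order_trans[OF nn_integral_mono u1] ll by (simp add: ennreal_leI)
    have Ts: "?T s z \<le> ennreal pi" for z
    proof -
      have "?T s z \<le> (\<integral>\<^sup>+w. ennreal (exp (- (cmod (z - w))\<^sup>2)) * 1 \<partial>lborel)"
        using s(2) by (intro nn_integral_mono mult_left_mono) auto
      then show ?thesis by (simp add: nn_integral_gaussian_kernel_right)
    qed
    have Tl: "?T l z \<le> 1" for z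
    proof -
      have "?T l z \<le> (\<integral>\<^sup>+w. 1 * ennreal (l w) \<partial>lborel)"
        by (intro nn_integral_mono mult_right_mono) auto
      then show ?thesis using intl by simp
    qed
    define ts tl where "ts z = enn2real (?T s z)" and "tl z = enn2real (?T l z)" for z
    have [measurable]: "ts \<in> borel_measurable borel" "tl \<in> borel_measurable borel"
      unfolding ts_def tl_def by measurable
    have ts: "ennreal (ts z) = ?T s z" "0 \<le> ts z" "ts z \<le> pi" for z
      using Ts[of z] by (auto simp: ts_def ennreal_enn2real_if top_unique enn2real_leI)
    have tl: "ennreal (tl z) = ?T l z" "0 \<le> tl z" "tl z \<le> 1" for z
      using Tl[of z] by (auto simp: tl_def ennreal_enn2real_if top_unique enn2real_leI)
    have vle: "v z \<le> ts z + tl z" for z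
    proof -
      have "?T u z = ?T s z + ?T l z"
        by (subst nn_integral_add[symmetric])
           (auto simp: s_def l_def intro!: nn_integral_cong)
      then have "ennreal (v z) \<le> ennreal (ts z + tl z)"
        using v[of z] ts tl by simp
      then show ?thesis using ts(2) tl(2) by (subst (asm) ennreal_le_iff) auto
    qed
    \<comment> \<open>The 2 in the denominator turns a sum into a mean, which is at most the
      maximum; the power of a maximum is at most the sum of the powers.\<close>
    have pw: "(v z / (2 * pi)) powr p z \<le> (ts z / pi) powr p z + (tl z / pi) powr p z" for z
    proof -
      have "v z / (2 * pi) \<le> max (ts z / pi) (tl z / pi)"
        using vle[of z] pi_gt_zero by (auto simp: max_def field_simps)
      then have "(v z / (2 * pi)) powr p z \<le> (max (ts z / pi) (tl z / pi)) powr p z"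
        using v0 p_ge_1[of z] by (intro powr_mono2) auto
      also have "\<dots> \<le> (ts z / pi) powr p z + (tl z / pi) powr p z"
        by (auto simp: max_def)
      finally show ?thesis .
    qed
    \<comment> \<open>Since \<open>tl z / pi\<close> is at most 1, the exponent can be lowered to 1,
      and the integral of the average is computed by Fubini.\<close>
    have Il: "(\<integral>\<^sup>+z. ennreal ((tl z / pi) powr p z) \<partial>lborel) \<le> ennreal 1"
    proof -
      have "(tl z / pi) powr p z \<le> (1 / pi) * tl z" for z
      proof -
        have "tl z / pi \<le> 1" using tl(3)[of z] pi_ge_two by (simp add: field_simps)
        then have "(tl z / pi) powr p z \<le> (tl z / pi) powr 1"
          using tl(2)[of z] p_ge_1[of z] by (intro powr_mono') auto
        then show ?thesis using tl(2)[of z] by simp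
      qed
      then have "(\<integral>\<^sup>+z. ennreal ((tl z / pi) powr p z) \<partial>lborel) \<le> (\<integral>\<^sup>+z. ennreal (1 / pi) * ?T l z \<partial>lborel)"
        unfolding tl(1)[symmetric] using tl(2)
        by (intro nn_integral_mono) (simp add: ennreal_mult[symmetric] ennreal_leI)
      also have "\<dots> = ennreal (1 / pi) * (ennreal pi * (\<integral>\<^sup>+w. ennreal (l w) \<partial>lborel))"
        by (subst nn_integral_cmult) (auto simp: nn_integral_gaussian_average)
      also have "\<dots> = (\<integral>\<^sup>+w. ennreal (l w) \<partial>lborel)"
        by (simp add: mult.assoc[symmetric] ennreal_mult[symmetric])
      finally show ?thesis using intl by simp
    qed
    \<comment> \<open>The exponent \<open>p\<close> is replaced by \<open>pinf\<close> on
      \<open>s\<close>, Jensen's inequality is applied with the constant exponent, and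
      \<open>pinf\<close> is replaced by \<open>p\<close> on the average.\<close>
    have Is: "(\<integral>\<^sup>+z. ennreal ((ts z / pi) powr p z) \<partial>lborel) \<le> ennreal (exp (4 * C) * (exp (4 * C) + E) + E)"
    proof -
      have "(\<integral>\<^sup>+w. ennreal (s w powr pinf) \<partial>lborel)
          \<le> (\<integral>\<^sup>+w. ennreal (exp (4 * C)) * ennreal (u w powr p w) + ennreal ((exp 1 + cmod w) powr (-4)) \<partial>lborel)"
      proof (intro nn_integral_mono)
        fix w
        have "s w powr pinf \<le> exp (4 * C) * s w powr p w + (exp 1 + cmod w) powr (-4)"
          using p_decay[of w] s pinf_ge_1 by (intro powr_le_powr_add_decay) (auto simp: abs_minus_commute)
        also have "\<dots> \<le> exp (4 * C) * u w powr p w + (exp 1 + cmod w) powr (-4)"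
          using s p_ge_1[of w] by (intro add_right_mono mult_left_mono powr_mono2) auto
        finally show "ennreal (s w powr pinf) \<le> ennreal (exp (4 * C)) * ennreal (u w powr p w) + ennreal ((exp 1 + cmod w) powr (-4))"
          by (simp add: ennreal_mult[symmetric] ennreal_leI flip: ennreal_plus)
      qed
      also have "\<dots> = ennreal (exp (4 * C)) * (\<integral>\<^sup>+w. ennreal (u w powr p w) \<partial>lborel) + ennreal E"
        by (simp add: nn_integral_add nn_integral_cmult E(2))
      also have "\<dots> \<le> ennreal (exp (4 * C)) * 1 + ennreal E"
        by (intro add_right_mono mult_left_mono u1) auto
      finally have Isp: "(\<integral>\<^sup>+w. ennreal (s w powr pinf) \<partial>lborel) \<le> ennreal (exp (4 * C) + E)"
        using E by simp
      have "(\<integral>\<^sup>+z. ennreal ((ts z / pi) powr p z) \<partial>lborel)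
          \<le> (\<integral>\<^sup>+z. ennreal (exp (4 * C)) * ennreal ((ts z / pi) powr pinf) + ennreal ((exp 1 + cmod z) powr (-4)) \<partial>lborel)"
      proof (intro nn_integral_mono)
        fix z
        have "(ts z / pi) powr p z \<le> exp (4 * C) * (ts z / pi) powr pinf + (exp 1 + cmod z) powr (-4)"
          using p_decay[of z] ts(2,3)[of z] p_ge_1 by (intro powr_le_powr_add_decay) auto
        then show "ennreal ((ts z / pi) powr p z) \<le> ennreal (exp (4 * C)) * ennreal ((ts z / pi) powr pinf) + ennreal ((exp 1 + cmod z) powr (-4))"
          by (simp add: ennreal_mult[symmetric] ennreal_leI flip: ennreal_plus)
      qed
      also have "\<dots> = ennreal (exp (4 * C)) * (\<integral>\<^sup>+z. ennreal ((ts z / pi) powr pinf) \<partial>lborel) + ennreal E"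
        by (simp add: nn_integral_add nn_integral_cmult E(2))
      also have "(\<integral>\<^sup>+z. ennreal ((ts z / pi) powr pinf) \<partial>lborel)
          \<le> (\<integral>\<^sup>+z. ennreal (1 / pi) * (\<integral>\<^sup>+w. ennreal (exp (- (cmod (z - w))\<^sup>2)) * ennreal (s w powr pinf) \<partial>lborel) \<partial>lborel)"
        using s ts pinf_ge_1 by (intro nn_integral_mono gaussian_average_powr_le) auto
      also have "\<dots> = ennreal (1 / pi) * (ennreal pi * (\<integral>\<^sup>+w. ennreal (s w powr pinf) \<partial>lborel))"
        by (subst nn_integral_cmult) (auto simp: nn_integral_gaussian_average)
      also have "\<dots> = (\<integral>\<^sup>+w. ennreal (s w powr pinf) \<partial>lborel)"
        by (simp add: mult.assoc[symmetric] ennreal_mult[symmetric])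
      also note Isp
      finally show ?thesis
        using E by (simp add: ennreal_mult[symmetric] mult_left_mono add_right_mono flip: ennreal_plus)
    qed
    have "(\<integral>\<^sup>+z. ennreal ((v z / (2 * pi * D)) powr p z) \<partial>lborel)
        \<le> (\<integral>\<^sup>+z. ennreal (1 / D) * (ennreal ((ts z / pi) powr p z) + ennreal ((tl z / pi) powr p z)) \<partial>lborel)"
    proof (intro nn_integral_mono)
      fix z
      \<comment> \<open>As \<open>D\<close> and \<open>p z\<close> are at least 1, dividing the
        function by \<open>D\<close> divides the modular by at least \<open>D\<close>, which brings
        the bound \<open>D\<close> down to 1.\<close>
      have "(v z / (2 * pi * D)) powr p z = (1 / D) powr p z * (v z / (2 * pi)) powr p z"
        using v0[of z] D by (subst powr_mult[symmetric]) (auto simp: field_simps)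
      also have "\<dots> \<le> (1 / D) powr 1 * ((ts z / pi) powr p z + (tl z / pi) powr p z)"
        using D p_ge_1[of z] pw[of z] by (intro mult_mono powr_mono') auto
      finally show "ennreal ((v z / (2 * pi * D)) powr p z)
          \<le> ennreal (1 / D) * (ennreal ((ts z / pi) powr p z) + ennreal ((tl z / pi) powr p z))"
        using D by (simp add: ennreal_mult[symmetric] ennreal_leI flip: ennreal_plus)
    qed
    also have "\<dots> = ennreal (1 / D) * ((\<integral>\<^sup>+z. ennreal ((ts z / pi) powr p z) \<partial>lborel) + (\<integral>\<^sup>+z. ennreal ((tl z / pi) powr p z) \<partial>lborel))"
      by (simp add: nn_integral_cmult nn_integral_add)
    also have "\<dots> \<le> ennreal (1 / D) * (ennreal (exp (4 * C) * (exp (4 * C) + E) + E) + ennreal 1)"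
      by (intro mult_left_mono add_mono Is Il) auto
    also have "\<dots> = ennreal (1 / D * D)"
      using E D by (simp add: D_def ennreal_mult[symmetric] add.commute flip: ennreal_plus del: ennreal_1)
    also have "\<dots> = 1" using D by simp
    finally show ?thesis .
  qed
  moreover have "2 * pi * D \<ge> 1"
    using D pi_ge_two mult_mono[of 1 "2 * pi" 1 D] by simp
  ultimately show ?thesis using that[of "2 * pi * D"] by blast
qed

end

section \<open>The modular and the Luxemburg norm\<close>

text \<open>The weight is itself a power with exponent \<open>q z\<close>, so the weighted modular
  of \<open>f\<close> is the plain modular of \<open>cmod (f z)\<close> times a Gaussian. All
  estimates work with that product.\<close>

lemma modular_eq:
  "modular q f = (\<integral>\<^sup>+z. ennreal ((cmod (f z) * exp (- (cmod z)\<^sup>2)) powr q z) \<partial>lborel)"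
  unfolding modular_def
  by (intro nn_integral_cong arg_cong[where f=ennreal])
     (simp add: powr_mult exp_powr_real mult.commute)

lemma L_norm_le:
  assumes "t > 0" "modular q (\<lambda>z. f z / complex_of_real t) \<le> 1"
  shows "L_norm q f \<le> t"
  unfolding L_norm_def by (rule cInf_lower) (use assms in \<open>auto intro!: bdd_belowI[of _ 0]\<close>)

context bounded_exponent
begin

lemma modular_mono:
  assumes "\<And>z. cmod (f z) \<le> cmod (g z)"
  shows "modular p f \<le> modular p g"
  unfolding modular_eq using assms p_ge_1
  by (intro nn_integral_mono ennreal_leI powr_mono2 mult_right_mono) (auto intro: order_trans[OF zero_le_one])

lemma modular_contract_le:
  assumes [measurable]: "f \<in> borel_measurable borel" and c: "0 \<le> c" "c \<le> 1"
  shows "modular p (\<lambda>z. complex_of_real c * f z) \<le> ennreal c * modular p f"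
proof -
  have "modular p (\<lambda>z. complex_of_real c * f z)
      \<le> (\<integral>\<^sup>+z. ennreal c * ennreal ((cmod (f z) * exp (- (cmod z)\<^sup>2)) powr p z) \<partial>lborel)"
    unfolding modular_eq
  proof (intro nn_integral_mono)
    fix z
    have "(cmod (complex_of_real c * f z) * exp (- (cmod z)\<^sup>2)) powr p z
        = c powr p z * (cmod (f z) * exp (- (cmod z)\<^sup>2)) powr p z"
      using c by (subst powr_mult[symmetric]) (auto simp: norm_mult mult.assoc)
    also have "c powr p z \<le> c powr 1"
      using c p_ge_1[of z] by (intro powr_mono') auto
    finally show "ennreal ((cmod (complex_of_real c * f z) * exp (- (cmod z)\<^sup>2)) powr p z)
        \<le> ennreal c * ennreal ((cmod (f z) * exp (- (cmod z)\<^sup>2)) powr p z)"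
      using c by (simp add: ennreal_mult[symmetric] ennreal_leI mult_right_mono)
  qed
  also have "\<dots> = ennreal c * modular p f"
    unfolding modular_eq by (rule nn_integral_cmult) simp
  finally show ?thesis .
qed

text \<open>The upper bound on the exponent makes the factor uniform, with \<open>d\<close> at least
  1 so that its powers increase. Finiteness of the modular is thus invariant under scaling, and
  membership in the space no longer mentions a scale.\<close>

lemma modular_cmult_finite:
  assumes [measurable]: "f \<in> borel_measurable borel" and f: "modular p f < top"
  shows "modular p (\<lambda>z. c * f z) < top"
proof -
  define d where "d = max 1 (cmod c)"
  have "modular p (\<lambda>z. c * f z)
      \<le> (\<integral>\<^sup>+z. ennreal (d powr b) * ennreal ((cmod (f z) * exp (- (cmod z)\<^sup>2)) powr p z) \<partial>lborel)"
    unfolding modular_eq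
  proof (intro nn_integral_mono)
    fix z
    have "(cmod (c * f z) * exp (- (cmod z)\<^sup>2)) powr p z
        = cmod c powr p z * (cmod (f z) * exp (- (cmod z)\<^sup>2)) powr p z"
      by (subst powr_mult[symmetric]) (auto simp: norm_mult mult.assoc)
    also have "cmod c powr p z \<le> d powr p z"
      using p_ge_1[of z] by (intro powr_mono2) (auto simp: d_def)
    also have "d powr p z \<le> d powr b"
      using p_le_b by (intro powr_mono) (auto simp: d_def)
    finally show "ennreal ((cmod (c * f z) * exp (- (cmod z)\<^sup>2)) powr p z)
        \<le> ennreal (d powr b) * ennreal ((cmod (f z) * exp (- (cmod z)\<^sup>2)) powr p z)"
      by (simp add: ennreal_mult[symmetric] ennreal_leI mult_right_mono)
  qed
  also have "\<dots> = ennreal (d powr b) * modular p f"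
    unfolding modular_eq by (rule nn_integral_cmult) simp
  also have "\<dots> < top" using f by (simp add: ennreal_mult_less_top)
  finally show ?thesis .
qed

lemma modular_add_le:
  assumes [measurable]: "f \<in> borel_measurable borel" "g \<in> borel_measurable borel"
  shows "modular p (\<lambda>z. f z + g z) \<le> modular p (\<lambda>z. 2 * f z) + modular p (\<lambda>z. 2 * g z)"
proof -
  have "modular p (\<lambda>z. f z + g z) \<le>
     (\<integral>\<^sup>+z. ennreal ((cmod (2 * f z) * exp (- (cmod z)\<^sup>2)) powr p z) + ennreal ((cmod (2 * g z) * exp (- (cmod z)\<^sup>2)) powr p z) \<partial>lborel)"
    unfolding modular_eq
  proof (intro nn_integral_mono)
    fix z
    let ?m = "max (cmod (2 * f z)) (cmod (2 * g z))"
    have "cmod (f z + g z) \<le> ?m"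
      using norm_triangle_ineq[of "f z" "g z"] by (auto simp: norm_mult max_def)
    then have "(cmod (f z + g z) * exp (- (cmod z)\<^sup>2)) powr p z \<le> (?m * exp (- (cmod z)\<^sup>2)) powr p z"
      using p_ge_1[of z] by (intro powr_mono2 mult_right_mono) auto
    also have "\<dots> \<le> (cmod (2 * f z) * exp (- (cmod z)\<^sup>2)) powr p z + (cmod (2 * g z) * exp (- (cmod z)\<^sup>2)) powr p z"
      by (auto simp: max_def)
    finally show "ennreal ((cmod (f z + g z) * exp (- (cmod z)\<^sup>2)) powr p z) \<le>
      ennreal ((cmod (2 * f z) * exp (- (cmod z)\<^sup>2)) powr p z) + ennreal ((cmod (2 * g z) * exp (- (cmod z)\<^sup>2)) powr p z)"
      by (simp add: ennreal_leI flip: ennreal_plus)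
  qed
  also have "\<dots> = modular p (\<lambda>z. 2 * f z) + modular p (\<lambda>z. 2 * g z)"
    unfolding modular_eq by (rule nn_integral_add) auto
  finally show ?thesis .
qed

lemma in_L_iff: "in_L p f \<longleftrightarrow> f \<in> borel_measurable borel \<and> modular p f < top"
proof
  assume "in_L p f"
  then obtain t where [measurable]: "f \<in> borel_measurable borel" and t: "t > 0" "modular p (\<lambda>z. complex_of_real t * f z) < top"
    by (auto simp: in_L_def)
  have "modular p (\<lambda>z. complex_of_real (1 / t) * (complex_of_real t * f z)) < top"
    by (rule modular_cmult_finite) (use t in auto)
  then show "f \<in> borel_measurable borel \<and> modular p f < top"
    using t by simp
next
  assume "f \<in> borel_measurable borel \<and> modular p f < top"
  then show "in_L p f"
    by (auto simp: in_L_def intro!: exI[of _ 1])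
qed

lemma modular_divide_mono:
  assumes st: "0 < s" "s \<le> t" and s: "modular p (\<lambda>z. f z / complex_of_real s) \<le> 1"
  shows "modular p (\<lambda>z. f z / complex_of_real t) \<le> 1"
  using st by (intro order_trans[OF modular_mono s]) (auto simp: norm_divide intro!: divide_left_mono)

text \<open>Estimates are mostly phrased with an admissible scale in place of \<open>L_norm\<close>,
  which keeps the question whether the infimum is attained out of them.\<close>

lemma in_L_admissible_scale:
  assumes "in_L p f"
  obtains s where "s > 0" "modular p (\<lambda>z. f z / complex_of_real s) \<le> 1"
proof -
  have [measurable]: "f \<in> borel_measurable borel" and fin: "modular p f < top"
    using assms by (auto simp: in_L_iff)
  define s where "s = max 1 (enn2real (modular p f))"
  have s: "s \<ge> 1" "modular p f \<le> ennreal s"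
    using fin by (auto simp: s_def ennreal_enn2real_if intro: order_trans[OF _ ennreal_leI[OF max.cobounded2]])
  have "modular p (\<lambda>z. complex_of_real (1 / s) * f z) \<le> ennreal (1 / s) * modular p f"
    using s by (intro modular_contract_le) auto
  also have "\<dots> \<le> ennreal (1 / s) * ennreal s"
    by (intro mult_left_mono s) auto
  also have "\<dots> = 1" using s by (simp add: ennreal_mult[symmetric])
  finally show ?thesis using s by (intro that[of s]) auto
qed

lemma L_norm_nonneg:
  assumes "in_L p f"
  shows "0 \<le> L_norm p f"
  unfolding L_norm_def by (rule cInf_greatest) (use in_L_admissible_scale[OF assms] in auto)

lemma modular_le_1_of_L_norm_less:
  assumes "in_L p f" "L_norm p f < t"
  shows "modular p (\<lambda>z. f z / complex_of_real t) \<le> 1"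
proof -
  have "{t. t > 0 \<and> modular p (\<lambda>z. f z / complex_of_real t) \<le> 1} \<noteq> {}"
    using in_L_admissible_scale[OF assms(1)] by blast
  then obtain s where "s > 0" "modular p (\<lambda>z. f z / complex_of_real s) \<le> 1" "s < t"
    using assms(2) unfolding L_norm_def by (subst (asm) cInf_less_iff) (auto intro!: bdd_belowI[of _ 0])
  then show ?thesis
    by (intro modular_divide_mono[of s t]) auto
qed

lemma Fock_iff: "f \<in> Fock p \<longleftrightarrow> f holomorphic_on UNIV \<and> modular p f < top"
proof -
  have "f \<in> borel_measurable borel" if "f holomorphic_on UNIV"
    using that by (intro borel_measurable_continuous_onI holomorphic_on_imp_continuous_on)
  then show ?thesis by (auto simp: Fock_def in_L_iff)
qed

lemma Fock_measurable: "f \<in> Fock p \<Longrightarrow> f \<in> borel_measurable borel"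
  by (auto simp: Fock_def in_L_def)

lemma Fock_cmult: "f \<in> Fock p \<Longrightarrow> (\<lambda>z. c * f z) \<in> Fock p"
  using Fock_measurable[of f] by (auto simp: Fock_iff intro!: holomorphic_intros modular_cmult_finite)

lemma Fock_add:
  assumes f: "f \<in> Fock p" and g: "g \<in> Fock p"
  shows "(\<lambda>z. f z + g z) \<in> Fock p"
  using modular_add_le[OF Fock_measurable[OF f] Fock_measurable[OF g]] f g Fock_cmult[OF f, of 2] Fock_cmult[OF g, of 2]
  by (auto simp: Fock_iff intro!: holomorphic_intros elim!: order_le_less_trans)

lemma Fock_0: "(\<lambda>z. 0) \<in> Fock p"
  by (auto simp: Fock_iff modular_eq)

text \<open>Growth of exponential type costs half of the Gaussian weight, by the inequality between
  \<open>t * cmod z\<close> and half the sum of squares; the other half is integrable.\<close>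

lemma modular_exp_finite:
  "modular p (\<lambda>z. complex_of_real (exp (t * cmod z))) < top"
proof -
  have "modular p (\<lambda>z. complex_of_real (exp (t * cmod z)))
      \<le> (\<integral>\<^sup>+z. ennreal (exp (b * t\<^sup>2 / 2)) * ennreal (exp (- (1 / 2) * (cmod z)\<^sup>2)) \<partial>lborel)"
    unfolding modular_eq
  proof (intro nn_integral_mono)
    fix z
    have sq: "t * cmod z \<le> t\<^sup>2 / 2 + (cmod z)\<^sup>2 / 2"
      using sum_squares_bound[of t "cmod z"] by simp
    have "(cmod (complex_of_real (exp (t * cmod z))) * exp (- (cmod z)\<^sup>2)) powr p z
        = exp (p z * (t * cmod z - (cmod z)\<^sup>2))"
      by (simp add: exp_add[symmetric] exp_powr_real mult.commute)
    also have "\<dots> \<le> exp (b * t\<^sup>2 / 2 + - (1 / 2) * (cmod z)\<^sup>2)"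
    proof -
      have "p z * (t * cmod z - (cmod z)\<^sup>2) \<le> p z * (t\<^sup>2 / 2 - (cmod z)\<^sup>2 / 2)"
        using sq p_ge_1[of z] by (intro mult_left_mono) auto
      moreover have "p z * (t\<^sup>2 / 2) \<le> b * (t\<^sup>2 / 2)"
        using p_le_b by (intro mult_right_mono) auto
      moreover have "1 * ((cmod z)\<^sup>2 / 2) \<le> p z * ((cmod z)\<^sup>2 / 2)"
        using p_ge_1 by (intro mult_right_mono) auto
      ultimately show ?thesis by (simp add: algebra_simps)
    qed
    finally show "ennreal ((cmod (complex_of_real (exp (t * cmod z))) * exp (- (cmod z)\<^sup>2)) powr p z)
       \<le> ennreal (exp (b * t\<^sup>2 / 2)) * ennreal (exp (- (1 / 2) * (cmod z)\<^sup>2))"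
      by (simp add: ennreal_mult[symmetric] exp_add[symmetric] ennreal_leI del: mult_minus_left)
  qed
  also have "\<dots> = ennreal (exp (b * t\<^sup>2 / 2)) * ennreal (pi / (1 / 2))"
    by (subst nn_integral_cmult) (simp_all only: nn_integral_gaussian_complex, auto)
  also have "\<dots> < top" by (simp add: ennreal_mult_less_top)
  finally show ?thesis .
qed

text \<open>The scale \<open>T\<close> is independent of \<open>f\<close> and \<open>M\<close>. A
  geometrically small factor \<open>M\<close> in a pointwise bound therefore becomes a geometrically
  small scale.\<close>

lemma exp_admissible_scale:
  obtains T where "T > 0" "\<And>f M. M > 0 \<Longrightarrow> (\<And>z. cmod (f z) \<le> M * exp (t * cmod z)) \<Longrightarrow>
    modular p (\<lambda>z. f z / complex_of_real (M * T)) \<le> 1"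
proof -
  have "in_L p (\<lambda>z. complex_of_real (exp (t * cmod z)))"
    by (auto simp: in_L_iff modular_exp_finite intro!: borel_measurable_continuous_onI continuous_intros)
  then obtain T where T: "T > 0" "modular p (\<lambda>z. complex_of_real (exp (t * cmod z)) / complex_of_real T) \<le> 1"
    by (rule in_L_admissible_scale)
  show ?thesis
  proof (rule that[OF T(1)])
    fix f M assume M: "M > 0" and le: "\<And>z. cmod (f z) \<le> M * exp (t * cmod z)"
    have "cmod (f z / complex_of_real (M * T)) \<le> cmod (complex_of_real (exp (t * cmod z)) / complex_of_real T)" for z
      using M T(1) le[of z] by (simp add: norm_divide norm_mult divide_simps mult.commute)
    then show "modular p (\<lambda>z. f z / complex_of_real (M * T)) \<le> 1"
      by (rule order_trans[OF modular_mono T(2)])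
  qed
qed

lemma Fock_of_exp_bound:
  assumes f: "f holomorphic_on UNIV" and le: "\<And>z. cmod (f z) \<le> M * exp (t * cmod z)"
  shows "f \<in> Fock p"
proof -
  have "modular p f \<le> modular p (\<lambda>z. complex_of_real M * complex_of_real (exp (t * cmod z)))"
    using le by (intro modular_mono) (auto simp: norm_mult intro!: order_trans[OF le] mult_right_mono)
  also have "\<dots> < top"
    by (intro modular_cmult_finite modular_exp_finite borel_measurable_continuous_onI continuous_intros)
  finally show ?thesis using f by (simp add: Fock_iff)
qed

text \<open>Completing the square turns the integrand into a constant times the Gaussian kernel at
  \<open>z\<close> times \<open>u w\<close>. Where \<open>u w\<close> is at most 1 the kernel is a
  majorant, elsewhere \<open>u w powr p w\<close> is.\<close>

lemma integrable_fock_kernel: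
  assumes g: "in_L p g"
  shows "integrable lborel (\<lambda>w. g w * exp (2 * z * cnj w) * complex_of_real (exp (- 2 * (cmod w)\<^sup>2)))"
proof -
  obtain s where s: "s > 0" "modular p (\<lambda>z. g z / complex_of_real s) \<le> 1"
    using g by (rule in_L_admissible_scale)
  have [measurable]: "g \<in> borel_measurable borel" using g by (simp add: in_L_iff)
  have [measurable]: "(\<lambda>w. exp (2 * z * cnj w)) \<in> borel_measurable borel"
    by (intro borel_measurable_continuous_onI continuous_intros)
  define u where "u w = cmod (g w / complex_of_real s) * exp (- (cmod w)\<^sup>2)" for w
  have u0: "0 \<le> u w" for w by (simp add: u_def)
  have [measurable]: "u \<in> borel_measurable borel" unfolding u_def by measurable
  have "(\<integral>\<^sup>+w. ennreal (cmod (g w * exp (2 * z * cnj w) * complex_of_real (exp (- 2 * (cmod w)\<^sup>2)))) \<partial>lborel)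
      \<le> (\<integral>\<^sup>+w. ennreal (s * exp ((cmod z)\<^sup>2)) * (ennreal (exp (- (cmod (z - w))\<^sup>2)) + ennreal (u w powr p w)) \<partial>lborel)"
  proof (intro nn_integral_mono)
    fix w
    have "cmod (g w * exp (2 * z * cnj w) * complex_of_real (exp (- 2 * (cmod w)\<^sup>2)))
        = s * exp ((cmod z)\<^sup>2) * (exp (- (cmod (z - w))\<^sup>2) * u w)"
    proof -
      have "cmod (exp (2 * z * cnj w)) * exp (- 2 * (cmod w)\<^sup>2) = exp ((cmod z)\<^sup>2) * (exp (- (cmod (z - w))\<^sup>2) * exp (- (cmod w)\<^sup>2))"
        unfolding norm_exp_eq_Re exp_add[symmetric] cmod_power2 by (simp add: power2_eq_square algebra_simps)
      then show ?thesis
        using s by (simp add: u_def norm_mult norm_divide mult.assoc mult.left_commute)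
    qed
    also have "\<dots> \<le> s * exp ((cmod z)\<^sup>2) * (exp (- (cmod (z - w))\<^sup>2) + u w powr p w)"
    proof (intro mult_left_mono)
      show "exp (- (cmod (z - w))\<^sup>2) * u w \<le> exp (- (cmod (z - w))\<^sup>2) + u w powr p w"
      proof (cases "u w \<le> 1")
        case True
        then have "exp (- (cmod (z - w))\<^sup>2) * u w \<le> exp (- (cmod (z - w))\<^sup>2) * 1"
          by (intro mult_left_mono) auto
        then show ?thesis by (simp add: add_increasing2)
      next
        case False
        then have "u w powr 1 \<le> u w powr p w" using p_ge_1 by (intro powr_mono) auto
        then have "u w \<le> u w powr p w" using False by simp
        moreover have "exp (- (cmod (z - w))\<^sup>2) * u w \<le> u w"
          using u0 by (simp add: mult_left_le_one_le)
        moreover have "0 < exp (- (cmod (z - w))\<^sup>2)" by simp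
        ultimately show ?thesis by linarith
      qed
    qed (use s in auto)
    finally show "ennreal (cmod (g w * exp (2 * z * cnj w) * complex_of_real (exp (- 2 * (cmod w)\<^sup>2))))
       \<le> ennreal (s * exp ((cmod z)\<^sup>2)) * (ennreal (exp (- (cmod (z - w))\<^sup>2)) + ennreal (u w powr p w))"
      using s by (simp add: ennreal_mult[symmetric] ennreal_leI flip: ennreal_plus)
  qed
  also have "\<dots> = ennreal (s * exp ((cmod z)\<^sup>2)) * (ennreal pi + modular p (\<lambda>z. g z / complex_of_real s))"
    by (simp add: nn_integral_cmult nn_integral_add nn_integral_gaussian_kernel_right modular_eq u_def)
  also have "\<dots> < top"
    using s by (auto simp: ennreal_mult_less_top intro: order_le_less_trans)
  finally show ?thesis by (intro integrableI_bounded) auto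
qed

end

section \<open>Functionals, the Fock projection and kernel functions\<close>

definition fock_proj :: "(complex \<Rightarrow> complex) \<Rightarrow> complex \<Rightarrow> complex" where
  "fock_proj g z = complex_of_real (2 / pi) *
     (\<integral>w. g w * exp (2 * z * cnj w) * complex_of_real (exp (- 2 * (cmod w)\<^sup>2)) \<partial>lborel)"

lemma entire_power_series:
  assumes "\<And>z. (\<lambda>n. a n * z ^ n) sums f z"
  shows "f holomorphic_on UNIV"
proof -
  have "f field_differentiable at z" for z
  proof -
    have "f holomorphic_on ball 0 (cmod z + 1)"
      by (rule power_series_holomorphic[where a = a]) (use assms in simp)
    then show ?thesis
      by (rule holomorphic_on_imp_differentiable_at) auto
  qed
  then show ?thesis by (simp add: holomorphic_on_def)
qed

text \<open>Doubling the exponential type gains a factor \<open>(1 / 2) ^ n\<close> in the term of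
  order \<open>n\<close>. The tail is thus geometrically small relative to one fixed exponential,
  which is what convergence in norm requires.\<close>

lemma power_series_tail_le:
  fixes c :: "nat \<Rightarrow> complex"
  assumes c: "\<And>n. cmod (c n) \<le> M * \<rho> ^ n / fact n" and M: "0 \<le> M" and \<rho>: "0 \<le> \<rho>"
    and f: "(\<lambda>n. c n * z ^ n) sums y"
  shows "cmod (y - (\<Sum>n<N. c n * z ^ n)) \<le> M * (1 / 2) ^ N * exp (2 * \<rho> * cmod z)"
proof -
  define x where "x = 2 * \<rho> * cmod z"
  define d where "d n = M * (1 / 2) ^ N * (x ^ n / fact n)" for n :: nat
  have x: "0 \<le> x" using \<rho> by (simp add: x_def)
  have d0: "0 \<le> d n" for n using x M by (simp add: d_def)
  have d: "d sums (M * (1 / 2) ^ N * exp x)"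
    unfolding d_def using exp_converges[of x] by (intro sums_mult) (simp add: divide_inverse mult.commute)
  have "cmod (y - (\<Sum>n<N. c n * z ^ n)) \<le> M * (1 / 2) ^ N * exp x - (\<Sum>n<N. d n)"
  proof (rule norm_sums_le)
    show "(\<lambda>n. c (n + N) * z ^ (n + N)) sums (y - (\<Sum>n<N. c n * z ^ n))"
      using f by (rule sums_split_initial_segment)
    show "(\<lambda>n. d (n + N)) sums (M * (1 / 2) ^ N * exp x - (\<Sum>n<N. d n))"
      using d by (rule sums_split_initial_segment)
    fix n
    have "cmod (c (n + N) * z ^ (n + N)) \<le> (M * \<rho> ^ (n + N) / fact (n + N)) * cmod z ^ (n + N)"
      unfolding norm_mult norm_power using c by (intro mult_right_mono) auto
    also have "\<dots> = M * (1 / 2) ^ (n + N) * (x ^ (n + N) / fact (n + N))"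
      by (simp add: x_def power_mult_distrib power_one_over)
    also have "\<dots> \<le> d (n + N)"
      unfolding d_def using M x by (intro mult_right_mono mult_left_mono power_decreasing) auto
    finally show "cmod (c (n + N) * z ^ (n + N)) \<le> d (n + N)" .
  qed
  also have "\<dots> \<le> M * (1 / 2) ^ N * exp x"
    using sum_nonneg[of "{..<N}" d] d0 by simp
  finally show ?thesis by (simp add: x_def)
qed

lemma exp_sums_complex: "(\<lambda>n. x ^ n / fact n) sums exp x" for x :: complex
  using exp_converges[of x] by (simp add: scaleR_conv_of_real divide_inverse mult.commute)

context bounded_exponent
begin

lemma Fock_power_series:
  assumes c: "\<And>n. cmod (c n) \<le> M * \<rho> ^ n / fact n" and M: "0 \<le> M" and \<rho>: "0 \<le> \<rho>"
    and f: "\<And>z. (\<lambda>n. c n * z ^ n) sums f z"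
  shows "f \<in> Fock p"
proof (rule Fock_of_exp_bound[where t = "2 * \<rho>" and M = M])
  show "f holomorphic_on UNIV" using f by (rule entire_power_series)
  show "cmod (f z) \<le> M * exp (2 * \<rho> * cmod z)" for z
    using power_series_tail_le[OF c M \<rho> f[of z], of 0] by simp
qed

lemma Fock_power: "(\<lambda>z. z ^ n) \<in> Fock p"
proof (rule Fock_power_series[where c = "\<lambda>k. if k = n then 1 else 0" and M = "fact n" and \<rho> = 1])
  show "(\<lambda>k. (if k = n then 1 else 0) * z ^ k) sums z ^ n" for z :: complex
    using sums_single[of n "\<lambda>k. z ^ k"] by (simp add: if_distrib[of "\<lambda>x. x * _"] cong: if_cong)
qed auto

end

text \<open>\<open>K\<close> is any positive bound and not the norm itself, so the zero functional
  is included. The bound is expressed through admissible scales.\<close>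

locale fock_functional = bounded_exponent +
  fixes \<Lambda> :: "(complex \<Rightarrow> complex) \<Rightarrow> complex" and K :: real
  assumes \<Lambda>_add: "\<And>f g. f \<in> Fock p \<Longrightarrow> g \<in> Fock p \<Longrightarrow> \<Lambda> (\<lambda>z. f z + g z) = \<Lambda> f + \<Lambda> g"
    and \<Lambda>_cmult: "\<And>f c. f \<in> Fock p \<Longrightarrow> \<Lambda> (\<lambda>z. c * f z) = c * \<Lambda> f"
    and K_pos: "K > 0"
    and \<Lambda>_bound: "\<And>f t. f \<in> Fock p \<Longrightarrow> t > 0 \<Longrightarrow> modular p (\<lambda>z. f z / complex_of_real t) \<le> 1 \<Longrightarrow> cmod (\<Lambda> f) \<le> K * t"
begin

lemma \<Lambda>_diff:
  assumes "f \<in> Fock p" "g \<in> Fock p"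
  shows "(\<lambda>z. f z - g z) \<in> Fock p" "\<Lambda> (\<lambda>z. f z - g z) = \<Lambda> f - \<Lambda> g"
  using Fock_add[OF assms(1) Fock_cmult[OF assms(2), of "-1"]]
    \<Lambda>_add[OF assms(1) Fock_cmult[OF assms(2), of "-1"]] \<Lambda>_cmult[OF assms(2), of "-1"] by simp_all

lemma \<Lambda>_sum:
  assumes "\<And>n. f n \<in> Fock p"
  shows "(\<lambda>z. \<Sum>n<(N::nat). f n z) \<in> Fock p" "\<Lambda> (\<lambda>z. \<Sum>n<N. f n z) = (\<Sum>n<N. \<Lambda> (f n))"
proof (induction N)
  case 0
  { case 1 show ?case by (simp add: Fock_0) }
  { case 2 show ?case using \<Lambda>_cmult[OF Fock_0, of 0] by simp }
next
  case (Suc N)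
  { case 1 show ?case using Fock_add[OF Suc(1) assms[of N]] by simp }
  { case 2 show ?case using \<Lambda>_add[OF Suc(1) assms[of N]] Suc(2) by simp }
qed

text \<open>Coefficients of this size make the Taylor remainders geometrically small in norm, so a
  bound on \<open>\<Lambda>\<close> alone justifies applying it termwise.\<close>

lemma \<Lambda>_power_series:
  assumes c: "\<And>n. cmod (c n) \<le> M * \<rho> ^ n / fact n" and M: "0 < M" and \<rho>: "0 \<le> \<rho>"
    and f: "\<And>z. (\<lambda>n. c n * z ^ n) sums f z"
  shows "(\<lambda>n. c n * \<Lambda> (\<lambda>z. z ^ n)) sums \<Lambda> f"
proof -
  have fF: "f \<in> Fock p" using Fock_power_series[OF c _ \<rho> f] M by simp
  obtain T where T: "T > 0" "\<And>f M. M > 0 \<Longrightarrow> (\<And>z. cmod (f z) \<le> M * exp (2 * \<rho> * cmod z)) \<Longrightarrow>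
    modular p (\<lambda>z. f z / complex_of_real (M * T)) \<le> 1"
    using exp_admissible_scale[of "2 * \<rho>"] by blast
  let ?S = "\<lambda>N z. \<Sum>n<N. c n * z ^ n"
  have S: "?S N \<in> Fock p" "\<Lambda> (?S N) = (\<Sum>n<N. c n * \<Lambda> (\<lambda>z. z ^ n))" for N
    using \<Lambda>_sum[OF Fock_cmult[OF Fock_power]] by (simp_all add: \<Lambda>_cmult[OF Fock_power])
  have le: "cmod (\<Lambda> (?S N) - \<Lambda> f) \<le> K * M * T * (1 / 2) ^ N" for N
  proof -
    have "cmod (\<Lambda> (\<lambda>z. f z - ?S N z)) \<le> K * (M * (1 / 2) ^ N * T)"
    proof (rule \<Lambda>_bound)
      show "(\<lambda>z. f z - ?S N z) \<in> Fock p" by (rule \<Lambda>_diff(1)[OF fF S(1)])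
      show "modular p (\<lambda>z. (f z - ?S N z) / complex_of_real (M * (1 / 2) ^ N * T)) \<le> 1"
        using power_series_tail_le[OF c _ \<rho> f] M by (intro T(2)) auto
    qed (use M T in auto)
    then show ?thesis
      by (simp add: \<Lambda>_diff(2)[OF fF S(1)] norm_minus_commute mult_ac)
  qed
  have "(\<lambda>N. \<Lambda> (?S N) - \<Lambda> f) \<longlonglongrightarrow> 0"
  proof (rule Lim_null_comparison)
    show "\<forall>\<^sub>F N in sequentially. cmod (\<Lambda> (?S N) - \<Lambda> f) \<le> K * M * T * (1 / 2) ^ N"
      using le by simp
    show "(\<lambda>N. K * M * T * (1 / 2) ^ N) \<longlonglongrightarrow> 0"
      by (intro tendsto_mult_right_zero LIMSEQ_realpow_zero) auto
  qed
  then have "(\<lambda>N. \<Lambda> (?S N)) \<longlonglongrightarrow> \<Lambda> f" by (rule LIM_zero_cancel)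
  then show ?thesis by (simp add: S sums_def)
qed

definition rep :: "complex \<Rightarrow> complex" where
  "rep w = cnj (\<Lambda> (\<lambda>z. exp (2 * z * cnj w)))"

text \<open>The kernel is expanded in \<open>cnj w\<close>; the outer conjugation in
  \<open>rep\<close> turns this into a power series in \<open>w\<close>, hence an entire
  function.\<close>

lemma rep_sums: "(\<lambda>n. (cnj (\<Lambda> (\<lambda>z. z ^ n)) * 2 ^ n / fact n) * w ^ n) sums rep w"
proof -
  have "(\<lambda>n. (2 * cnj w) ^ n / fact n * \<Lambda> (\<lambda>z. z ^ n)) sums \<Lambda> (\<lambda>z. exp (2 * z * cnj w))"
  proof (rule \<Lambda>_power_series[where M = 1 and \<rho> = "2 * cmod w"])
    show "cmod ((2 * cnj w) ^ n / fact n) \<le> 1 * (2 * cmod w) ^ n / fact n" for n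
      by (simp add: norm_divide norm_power norm_mult)
    show "(\<lambda>n. (2 * cnj w) ^ n / fact n * z ^ n) sums exp (2 * z * cnj w)" for z
      using exp_sums_complex[of "2 * z * cnj w"] by (simp add: power_mult_distrib mult_ac)
  qed auto
  then have "(\<lambda>n. cnj ((2 * cnj w) ^ n / fact n * \<Lambda> (\<lambda>z. z ^ n))) sums rep w"
    unfolding rep_def by (simp only: sums_cnj)
  then show ?thesis by (simp add: power_mult_distrib mult_ac)
qed

lemma rep_holomorphic: "rep holomorphic_on UNIV"
  using rep_sums by (rule entire_power_series)

text \<open>Both sides are sums of the same series, whose terms combine the moments
  \<open>m n\<close> of \<open>g\<close> with the values of \<open>\<Lambda>\<close> on monomials.
  On the support of \<open>g\<close>, of radius at most \<open>R\<close>, both expansions are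
  dominated.\<close>

lemma \<Lambda>_fock_proj:
  assumes g: "integrable lborel (\<lambda>w. g w * complex_of_real (exp (- 2 * (cmod w)\<^sup>2)))"
    and R: "\<And>w. g w \<noteq> 0 \<Longrightarrow> cmod w \<le> R" "0 \<le> R"
  shows "fock_proj g \<in> Fock p" "\<Lambda> (fock_proj g) = pairing g rep"
proof -
  define g' where "g' w = g w * complex_of_real (exp (- 2 * (cmod w)\<^sup>2))" for w
  define m where "m n = (\<integral>w. g' w * cnj w ^ n \<partial>lborel)" for n
  define c where "c n = complex_of_real (2 / pi) * 2 ^ n / fact n * m n" for n
  \<comment> \<open>The summand 1 keeps \<open>M\<close> positive even if \<open>g\<close> vanishes
    almost everywhere.\<close>
  define M where "M = 2 / pi * (\<integral>w. cmod (g' w) \<partial>lborel) + 1"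
  have g': "integrable lborel g'" using g by (simp add: g'_def[abs_def])
  have [measurable]: "g' \<in> borel_measurable borel" using g' by auto
  have [measurable]: "cnj \<in> borel_measurable borel"
    by (intro borel_measurable_continuous_onI continuous_intros)
  have R': "cmod (cnj w) \<le> R" if "g' w \<noteq> 0" for w using R that by (auto simp: g'_def)
  have M: "0 < M" by (simp add: M_def add_nonneg_pos)
  have m_le: "cmod (m n) \<le> (\<integral>w. cmod (g' w) \<partial>lborel) * R ^ n" for n
  proof -
    have le: "cmod (g' w * cnj w ^ n) \<le> cmod (g' w) * R ^ n" for w
      using R'[of w] by (cases "g' w = 0") (auto simp: norm_mult norm_power intro!: mult_left_mono power_mono)
    have int: "integrable lborel (\<lambda>w. g' w * cnj w ^ n)"
      by (rule Bochner_Integration.integrable_bound[of lborel "\<lambda>w. cmod (g' w) * R ^ n"])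
         (use g' in \<open>auto intro!: AE_I2 order_trans[OF le] abs_ge_self\<close>)
    have "cmod (m n) \<le> (\<integral>w. cmod (g' w * cnj w ^ n) \<partial>lborel)"
      unfolding m_def by (rule integral_norm_bound)
    also have "\<dots> \<le> (\<integral>w. cmod (g' w) * R ^ n \<partial>lborel)"
      using le int g' by (intro integral_mono) auto
    finally show ?thesis by simp
  qed
  have c: "cmod (c n) \<le> M * (2 * R) ^ n / fact n" for n
  proof -
    have "cmod (c n) = 2 ^ n / fact n * (2 / pi * cmod (m n))"
      by (simp add: c_def norm_mult norm_divide norm_power mult_ac)
    also have "\<dots> \<le> 2 ^ n / fact n * (2 / pi * ((\<integral>w. cmod (g' w) \<partial>lborel) * R ^ n))"
      using m_le by (intro mult_left_mono) auto
    also have "\<dots> \<le> 2 ^ n / fact n * (M * R ^ n)"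
      using R unfolding M_def by (intro mult_left_mono) (auto simp: algebra_simps)
    finally show ?thesis by (simp add: power_mult_distrib mult_ac)
  qed
  have proj: "(\<lambda>n. c n * z ^ n) sums fock_proj g z" for z
  proof -
    have "(\<lambda>n. (2 * z) ^ n / fact n * (\<integral>w. g' w * cnj w ^ n \<partial>lborel)) sums
        (\<integral>w. g' w * (\<Sum>n. (2 * z) ^ n / fact n * cnj w ^ n) \<partial>lborel)"
    proof (rule sums_integral_power_series[OF g' _ R'])
      have "summable (\<lambda>n. (2 * cmod z * R) ^ n / fact n)"
        using summable_exp[of "2 * cmod z * R"] by (simp add: divide_inverse mult.commute)
      then show "summable (\<lambda>n. cmod ((2 * z) ^ n / fact n) * R ^ n)"
        by (simp add: norm_divide norm_power norm_mult power_mult_distrib mult_ac)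
    qed auto
    moreover have "(\<Sum>n. (2 * z) ^ n / fact n * cnj w ^ n) = exp (2 * z * cnj w)" for w
      using exp_sums_complex[of "2 * z * cnj w"] by (simp add: power_mult_distrib sums_iff)
    ultimately have "(\<lambda>n. complex_of_real (2 / pi) * ((2 * z) ^ n / fact n * m n)) sums
        (complex_of_real (2 / pi) * (\<integral>w. g' w * exp (2 * z * cnj w) \<partial>lborel))"
      unfolding m_def by (intro sums_mult) simp
    then show ?thesis
      by (simp add: c_def fock_proj_def g'_def power_mult_distrib mult_ac)
  qed
  show "fock_proj g \<in> Fock p"
    using Fock_power_series[OF c _ _ proj] M R by simp
  have "(\<lambda>n. c n * \<Lambda> (\<lambda>z. z ^ n)) sums \<Lambda> (fock_proj g)"
    using \<Lambda>_power_series[OF c M _ proj] R by simp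
  moreover have "(\<lambda>n. c n * \<Lambda> (\<lambda>z. z ^ n)) sums pairing g rep"
  proof -
    define a where "a n = \<Lambda> (\<lambda>z. z ^ n) * 2 ^ n / fact n" for n :: nat
    have rs: "(\<lambda>n. a n * cnj w ^ n) sums cnj (rep w)" for w
      using rep_sums[of w, THEN sums_cnj[THEN iffD2]] by (simp add: a_def)
    have "summable (\<lambda>n. cmod (a n * complex_of_real R ^ n))"
      by (rule powser_insidea[of _ "cnj (complex_of_real (R + 1))"]) (use rs[of "complex_of_real (R + 1)"] R in \<open>auto simp: sums_iff\<close>)
    then have "summable (\<lambda>n. cmod (a n) * R ^ n)" using R by (simp add: norm_mult norm_power)
    then have "(\<lambda>n. a n * (\<integral>w. g' w * cnj w ^ n \<partial>lborel)) sums
        (\<integral>w. g' w * (\<Sum>n. a n * cnj w ^ n) \<partial>lborel)"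
      by (intro sums_integral_power_series[OF g' _ R']) auto
    then have "(\<lambda>n. complex_of_real (2 / pi) * (a n * m n)) sums
        (complex_of_real (2 / pi) * (\<integral>w. g' w * cnj (rep w) \<partial>lborel))"
      using rs unfolding m_def by (intro sums_mult) (simp add: sums_iff)
    then show ?thesis
      by (simp add: c_def a_def pairing_def g'_def mult_ac)
  qed
  ultimately show "\<Lambda> (fock_proj g) = pairing g rep" by (rule sums_unique2)
qed

end

section \<open>Duality\<close>

lemma cball_measurable [measurable]: "cball (x :: 'a::metric_space) r \<in> sets borel"
  by (intro borel_closed closed_cball)

text \<open>The real part of \<open>2 * z * cnj w\<close> minus both squared moduli is minus the
  squared distance of \<open>z\<close> and \<open>w\<close>. The prefactor \<open>2 / pi\<close> is
  at most 1 and is dropped.\<close>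

lemma fock_proj_le:
  "ennreal (cmod (fock_proj g z) * exp (- (cmod z)\<^sup>2))
    \<le> (\<integral>\<^sup>+w. ennreal (exp (- (cmod (z - w))\<^sup>2)) * ennreal (cmod (g w) * exp (- (cmod w)\<^sup>2)) \<partial>lborel)"
proof (cases "integrable lborel (\<lambda>w. g w * exp (2 * z * cnj w) * complex_of_real (exp (- 2 * (cmod w)\<^sup>2)))")
  \<comment> \<open>The Bochner integral of a non-integrable function is 0 by default, so the left
    side vanishes.\<close>
  case False
  then show ?thesis by (simp add: fock_proj_def not_integrable_integral_eq)
next
  case True
  let ?G = "\<lambda>w. g w * exp (2 * z * cnj w) * complex_of_real (exp (- 2 * (cmod w)\<^sup>2))"
  have G: "exp (- (cmod z)\<^sup>2) * cmod (?G w) = exp (- (cmod (z - w))\<^sup>2) * (cmod (g w) * exp (- (cmod w)\<^sup>2))" for w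
  proof -
    have "exp (- (cmod z)\<^sup>2) * (cmod (exp (2 * z * cnj w)) * exp (- 2 * (cmod w)\<^sup>2)) = exp (- (cmod (z - w))\<^sup>2) * exp (- (cmod w)\<^sup>2)"
      unfolding norm_exp_eq_Re exp_add[symmetric] cmod_power2 by (simp add: power2_eq_square algebra_simps)
    then show ?thesis by (simp add: norm_mult mult_ac)
  qed
  have "cmod (fock_proj g z) \<le> 1 * (\<integral>w. cmod (?G w) \<partial>lborel)"
    unfolding fock_proj_def using pi_ge_two
    by (subst norm_mult, intro mult_mono integral_norm_bound) (auto simp: norm_divide)
  then have "cmod (fock_proj g z) * exp (- (cmod z)\<^sup>2) \<le> (\<integral>w. exp (- (cmod z)\<^sup>2) * cmod (?G w) \<partial>lborel)"
    by (simp add: mult.commute)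
  then have "ennreal (cmod (fock_proj g z) * exp (- (cmod z)\<^sup>2)) \<le> ennreal (\<integral>w. exp (- (cmod z)\<^sup>2) * cmod (?G w) \<partial>lborel)"
    by (rule ennreal_leI)
  also have "\<dots> = (\<integral>\<^sup>+w. ennreal (exp (- (cmod z)\<^sup>2) * cmod (?G w)) \<partial>lborel)"
    by (rule nn_integral_eq_integral[symmetric]) (use True in auto)
  also have "\<dots> = (\<integral>\<^sup>+w. ennreal (exp (- (cmod (z - w))\<^sup>2)) * ennreal (cmod (g w) * exp (- (cmod w)\<^sup>2)) \<partial>lborel)"
    unfolding G by (simp add: ennreal_mult)
  finally show ?thesis .
qed

lemma fock_proj_divide: "fock_proj (\<lambda>w. g w / c) z = fock_proj g z / c"
proof -
  have "(\<lambda>w. g w / c * exp (2 * z * cnj w) * complex_of_real (exp (- 2 * (cmod w)\<^sup>2)))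
      = (\<lambda>w. (g w * exp (2 * z * cnj w) * complex_of_real (exp (- 2 * (cmod w)\<^sup>2))) / c)"
    by (simp add: fun_eq_iff)
  then show ?thesis unfolding fock_proj_def by (simp only: integral_divide_zero times_divide_eq_right)
qed

context log_exponent
begin

lemma fock_proj_modular_bounded:
  obtains B where "B \<ge> 1" "\<And>g s. g \<in> borel_measurable borel \<Longrightarrow> s > 0 \<Longrightarrow>
    modular p (\<lambda>z. g z / complex_of_real s) \<le> 1 \<Longrightarrow>
    modular p (\<lambda>z. fock_proj g z / complex_of_real (B * s)) \<le> 1"
proof -
  obtain B where B: "B \<ge> 1"
    "\<And>u v. u \<in> borel_measurable borel \<Longrightarrow> (\<And>w. 0 \<le> u w) \<Longrightarrow>
       (\<integral>\<^sup>+w. ennreal (u w powr p w) \<partial>lborel) \<le> 1 \<Longrightarrow> (\<And>z. 0 \<le> v z) \<Longrightarrow>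
       (\<And>z. ennreal (v z) \<le> (\<integral>\<^sup>+w. ennreal (exp (- (cmod (z - w))\<^sup>2)) * ennreal (u w) \<partial>lborel)) \<Longrightarrow>
       (\<integral>\<^sup>+z. ennreal ((v z / B) powr p z) \<partial>lborel) \<le> 1"
    by (rule gaussian_average_modular_bounded) blast
  show ?thesis
  proof (rule that[OF B(1)])
    fix g s
    assume [measurable]: "g \<in> borel_measurable borel" and s: "s > 0" and m: "modular p (\<lambda>z. g z / complex_of_real s) \<le> 1"
    let ?g = "\<lambda>w. g w / complex_of_real s"
    have "(\<integral>\<^sup>+z. ennreal ((cmod (fock_proj ?g z) * exp (- (cmod z)\<^sup>2) / B) powr p z) \<partial>lborel) \<le> 1"
      using m unfolding modular_eq
      by (intro B(2)[where u = "\<lambda>w. cmod (?g w) * exp (- (cmod w)\<^sup>2)"] fock_proj_le) auto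
    then show "modular p (\<lambda>z. fock_proj g z / complex_of_real (B * s)) \<le> 1"
      using B(1) s unfolding modular_eq by (simp add: fock_proj_divide norm_divide norm_mult mult.commute)
  qed
qed

lemma p_gt_1: "1 < p z"
  using a_gt_1 a_le_p[of z] by linarith

lemma conj_exp_gt_1: "1 < conj_exp p z"
  using p_gt_1[of z] by (simp add: conj_exp_def field_simps)

lemma conj_exp_inverse: "1 / p z + 1 / conj_exp p z = 1"
  using p_gt_1[of z] by (simp add: conj_exp_def field_simps)

lemma conj_exp_mult: "(conj_exp p z - 1) * p z = conj_exp p z"
  using p_gt_1[of z] by (simp add: conj_exp_def field_simps)

lemma conj_exp_bounded: "bounded_exponent (conj_exp p) (a / (a - 1))"
proof
  show "conj_exp p \<in> borel_measurable borel" unfolding conj_exp_def by measurable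
  show "1 \<le> conj_exp p z" for z using conj_exp_gt_1[of z] by simp
  show "conj_exp p z \<le> a / (a - 1)" for z
    using p_gt_1[of z] a_gt_1 a_le_p[of z] by (simp add: conj_exp_def field_simps)
qed

sublocale conj: bounded_exponent "conj_exp p" "a / (a - 1)"
  by (rule conj_exp_bounded)

text \<open>Hoelder's inequality for Luxemburg norms. The Gaussian is shared equally between the
  factors; after scaling, Young's inequality bounds the integral by two modulars of at most 1 each,
  whence the constant 2.\<close>

lemma pairing_Young:
  assumes [measurable]: "f \<in> borel_measurable borel" "h \<in> borel_measurable borel"
    and s: "s > 0" "modular p (\<lambda>z. f z / complex_of_real s) \<le> 1"
    and t: "t > 0" "modular (conj_exp p) (\<lambda>z. h z / complex_of_real t) \<le> 1"
  shows "integrable lborel (\<lambda>z. f z * cnj (h z) * complex_of_real (exp (- 2 * (cmod z)\<^sup>2)))"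
    and "cmod (pairing f h) \<le> 2 * s * t"
proof -
  let ?I = "\<lambda>z. f z * cnj (h z) * complex_of_real (exp (- 2 * (cmod z)\<^sup>2))"
  let ?x = "\<lambda>z. cmod (f z / complex_of_real s) * exp (- (cmod z)\<^sup>2)"
  let ?y = "\<lambda>z. cmod (h z / complex_of_real t) * exp (- (cmod z)\<^sup>2)"
  have [measurable]: "cnj \<in> borel_measurable borel"
    by (intro borel_measurable_continuous_onI continuous_intros)
  have "(\<integral>\<^sup>+z. ennreal (cmod (?I z)) \<partial>lborel)
      \<le> (\<integral>\<^sup>+z. ennreal (s * t) * (ennreal (?x z powr p z) + ennreal (?y z powr conj_exp p z)) \<partial>lborel)"
  proof (intro nn_integral_mono)
    fix z
    have "cmod (?I z) = s * t * (?x z * ?y z)"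
      using s t by (simp add: norm_mult norm_divide exp_add[symmetric] mult_ac)
    also have "?x z * ?y z \<le> ?x z powr p z / p z + ?y z powr conj_exp p z / conj_exp p z"
      by (rule Youngs_inequality) (use p_gt_1 conj_exp_gt_1 conj_exp_inverse in auto)
    also have "\<dots> \<le> ?x z powr p z / 1 + ?y z powr conj_exp p z / 1"
      using p_gt_1[of z] conj_exp_gt_1[of z] by (intro add_mono divide_left_mono) auto
    finally show "ennreal (cmod (?I z)) \<le> ennreal (s * t) * (ennreal (?x z powr p z) + ennreal (?y z powr conj_exp p z))"
      using s t by (simp add: ennreal_mult[symmetric] ennreal_leI mult_left_mono flip: ennreal_plus)
  qed
  also have "\<dots> = ennreal (s * t) * (modular p (\<lambda>z. f z / complex_of_real s) + modular (conj_exp p) (\<lambda>z. h z / complex_of_real t))"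
    unfolding modular_eq by (subst nn_integral_cmult, simp, subst nn_integral_add) auto
  also have "\<dots> \<le> ennreal (s * t) * (1 + 1)"
    by (intro mult_left_mono add_mono s t) auto
  also have "\<dots> = ennreal (2 * s * t)"
    using s t by (simp add: ennreal_mult mult_ac)
  finally have le: "(\<integral>\<^sup>+z. ennreal (cmod (?I z)) \<partial>lborel) \<le> ennreal (2 * s * t)" .
  show int: "integrable lborel ?I"
    by (rule integrableI_bounded) (use le in \<open>auto intro: order_le_less_trans\<close>)
  have "cmod (pairing f h) \<le> 1 * (\<integral>z. cmod (?I z) \<partial>lborel)"
    unfolding pairing_def using pi_ge_two
    by (subst norm_mult, intro mult_mono integral_norm_bound) (auto simp: norm_divide)
  also have "\<dots> \<le> 2 * s * t"
  proof -
    have "ennreal (\<integral>z. cmod (?I z) \<partial>lborel) \<le> ennreal (2 * s * t)"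
      using le int by (simp add: nn_integral_eq_integral)
    then show ?thesis using s t by (subst (asm) ennreal_le_iff) auto
  qed
  finally show "cmod (pairing f h) \<le> 2 * s * t" .
qed

end

text \<open>The projection constant \<open>B\<close> is a parameter chosen before
  \<open>\<Lambda>\<close>, which keeps the final constants independent of the functional.\<close>

locale log_fock_functional =
  log_exponent p b a pinf C + fock_functional p b \<Lambda> K
  for p b a pinf C \<Lambda> K +
  fixes B :: real
  assumes B_ge_1: "B \<ge> 1"
    and proj_bound: "\<And>g s. g \<in> borel_measurable borel \<Longrightarrow> s > 0 \<Longrightarrow>
      modular p (\<lambda>z. g z / complex_of_real s) \<le> 1 \<Longrightarrow>
      modular p (\<lambda>z. fock_proj g z / complex_of_real (B * s)) \<le> 1"
begin

text \<open>On a ball \<open>rep\<close> is tested against the function for which the inequality of Young is an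
  equality. If the modular \<open>I\<close> of \<open>rep\<close> over the ball exceeded \<open>1\<close>, boundedness of \<open>\<Lambda>\<close> and of the
  projection would give \<open>I \<le> I powr (1 / a)\<close>.\<close>

lemma rep_modular_cball_le_1:
  assumes R: "R \<ge> 0"
  shows "(\<integral>\<^sup>+w. indicator (cball 0 R) w * ennreal ((cmod (rep w / complex_of_real (pi / 2 * K * B)) * exp (- (cmod w)\<^sup>2)) powr conj_exp p w) \<partial>lborel) \<le> 1"
    (is "?J \<le> 1")
proof (rule ccontr)
  assume gt: "\<not> ?J \<le> 1"
  \<comment> \<open>\<open>pi / 2\<close> cancels the prefactor of \<open>pairing\<close>, and
    \<open>K * B\<close> matches the bound on \<open>\<Lambda>\<close> after the projection; what is
    left in the end is \<open>I \<le> s\<close>.\<close>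
  define l where "l = pi / 2 * K * B"
  have l: "l > 0" using K_pos B_ge_1 by (simp add: l_def)
  define v where "v w = cmod (rep w) / l * exp (- (cmod w)\<^sup>2)" for w
  define ind where "ind w = (indicator (cball 0 R) w :: real)" for w :: complex
  let ?q = "conj_exp p"
  have cont: "continuous_on A rep" for A
    using holomorphic_on_imp_continuous_on[OF rep_holomorphic] continuous_on_subset by blast
  have [measurable]: "rep \<in> borel_measurable borel"
    using cont by (rule borel_measurable_continuous_onI)
  have [measurable]: "cnj \<in> borel_measurable borel"
    by (intro borel_measurable_continuous_onI continuous_intros)
  have [measurable]: "?q \<in> borel_measurable borel" by (rule conj.p_measurable)
  have [measurable]: "v \<in> borel_measurable borel" unfolding v_def by measurable
  have [measurable]: "ind \<in> borel_measurable borel" unfolding ind_def by measurable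
  have v0: "0 \<le> v w" for w using l by (simp add: v_def)
  have ind: "ind w = 0 \<or> ind w = 1 \<and> cmod w \<le> R" for w
    by (auto simp: ind_def indicator_def)
  obtain V where V: "V \<ge> 1" "\<And>w. cmod w \<le> R \<Longrightarrow> v w \<le> V"
  proof -
    have "compact (v ` cball 0 R)"
      unfolding v_def by (intro compact_continuous_image continuous_intros cont) (use l in auto)
    then have "bounded (v ` cball 0 R)" by (rule compact_imp_bounded)
    then obtain V where "\<And>w. w \<in> cball 0 R \<Longrightarrow> norm (v w) \<le> V"
      unfolding bounded_iff by blast
    then show ?thesis by (intro that[of "max 1 V"]) (auto intro: order_trans[OF abs_ge_self] simp: le_max_iff_disj)
  qed
  \<comment> \<open>As \<open>V\<close> is at least 1, this bounds every power of \<open>v\<close>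
    on the ball with exponent between 0 and \<open>?q w\<close>. The exponents used are
    \<open>?q w\<close> and \<open>?q w - 1\<close>.\<close>
  define W where "W = V powr (a / (a - 1))"
  have vW: "ind w * v w powr e \<le> W * ind w" if "0 \<le> e" "e \<le> ?q w" for w e
  proof (cases "ind w = 0")
    case False
    then have w: "ind w = 1" "cmod w \<le> R" using ind[of w] by auto
    have "v w powr e \<le> V powr e" using V w v0 that by (intro powr_mono2) auto
    also have "\<dots> \<le> W"
      unfolding W_def using V that conj.p_le_b[of w] by (intro powr_mono) auto
    finally show ?thesis using w by simp
  qed simp
  have intind: "integrable lborel ind"
    unfolding ind_def by (intro integrable_real_indicator) (auto simp: emeasure_lborel_cball_finite[simplified])
  have intv: "integrable lborel (\<lambda>w. ind w * v w powr ?q w)"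
  proof (rule Bochner_Integration.integrable_bound[of _ "\<lambda>w. W * ind w"])
    show "AE w in lborel. norm (ind w * v w powr ?q w) \<le> norm (W * ind w)"
    proof (intro AE_I2)
      fix w
      have "0 \<le> ?q w" using conj_exp_gt_1[of w] by linarith
      then have "ind w * v w powr ?q w \<le> W * ind w" by (intro vW) auto
      moreover have "0 \<le> ind w * v w powr ?q w" by (simp add: ind_def)
      ultimately show "norm (ind w * v w powr ?q w) \<le> norm (W * ind w)" by simp
    qed
  qed (use intind in auto)
  define I where "I = (\<integral>w. ind w * v w powr ?q w \<partial>lborel)"
  have ind0: "0 \<le> ind w" for w by (simp add: ind_def)
  have nnI: "(\<integral>\<^sup>+w. ennreal (ind w * v w powr ?q w) \<partial>lborel) = ennreal I"
    unfolding I_def using intv ind0 by (intro nn_integral_eq_integral) auto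
  have "?J = (\<integral>\<^sup>+w. ennreal (ind w * v w powr ?q w) \<partial>lborel)"
    unfolding l_def[symmetric] using l
    by (intro nn_integral_cong) (auto simp: ind_def v_def norm_divide indicator_def)
  then have I: "I > 1" using gt unfolding nnI by (simp add: not_le)
  \<comment> \<open>The power \<open>?q w - 1\<close> gives \<open>v w powr ?q w\<close> after
    raising to \<open>p w\<close>, the sign makes the product with \<open>cnj (rep w)\<close>
    nonnegative, and the exponential compensates the weight.\<close>
  define g where "g w = complex_of_real (ind w * v w powr (?q w - 1) * exp ((cmod w)\<^sup>2)) * sgn (rep w)" for w
  have [measurable]: "g \<in> borel_measurable borel"
    unfolding g_def sgn_div_norm by measurable
  have gx: "cmod (g w) * exp (- (cmod w)\<^sup>2) = ind w * v w powr (?q w - 1)" for w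
  proof (cases "rep w = 0")
    case True
    then show ?thesis by (simp add: g_def v_def)
  next
    case False
    then show ?thesis using ind0[of w]
      by (simp add: g_def norm_mult norm_sgn mult.assoc exp_add[symmetric])
  qed
  have gp: "(cmod (g w) * exp (- (cmod w)\<^sup>2)) powr p w = ind w * v w powr ?q w" for w
    unfolding gx using ind[of w] p_gt_1[of w] by (auto simp: powr_powr conj_exp_mult)
  \<comment> \<open>Since \<open>s\<close> is at least 1, \<open>s powr p w\<close> is at least
    \<open>s powr a = I\<close>. Dividing \<open>g\<close> by \<open>s\<close> thus reduces its
    modular from \<open>I\<close> to at most 1.\<close>
  define s where "s = I powr (1 / a)"
  have s1: "s \<ge> 1" unfolding s_def using I a_gt_1 by (intro ge_one_powr_ge_zero) auto
  have sa: "s powr a = I" unfolding s_def using I a_gt_1 by (simp add: powr_powr)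
  have "modular p (\<lambda>w. g w / complex_of_real s) \<le> (\<integral>\<^sup>+w. ennreal (1 / I) * ennreal (ind w * v w powr ?q w) \<partial>lborel)"
    unfolding modular_eq
  proof (intro nn_integral_mono)
    fix w
    have "(cmod (g w / complex_of_real s) * exp (- (cmod w)\<^sup>2)) powr p w = (cmod (g w) * exp (- (cmod w)\<^sup>2)) powr p w / s powr p w"
      using s1 by (subst powr_divide[symmetric]) (auto simp: norm_divide)
    also have "\<dots> \<le> (cmod (g w) * exp (- (cmod w)\<^sup>2)) powr p w / s powr a"
      using s1 a_le_p[of w] by (intro divide_left_mono powr_mono) auto
    finally have "(cmod (g w / complex_of_real s) * exp (- (cmod w)\<^sup>2)) powr p w \<le> 1 / I * (ind w * v w powr ?q w)"
      by (simp add: gp sa)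
    then show "ennreal ((cmod (g w / complex_of_real s) * exp (- (cmod w)\<^sup>2)) powr p w) \<le> ennreal (1 / I) * ennreal (ind w * v w powr ?q w)"
      using I ind0 by (simp add: ennreal_mult[symmetric] ennreal_leI)
  qed
  also have "\<dots> = 1"
    using I by (subst nn_integral_cmult) (auto simp: nnI ennreal_mult[symmetric])
  finally have m: "modular p (\<lambda>w. g w / complex_of_real s) \<le> 1" .
  have gint: "integrable lborel (\<lambda>w. g w * complex_of_real (exp (- 2 * (cmod w)\<^sup>2)))"
  proof (rule Bochner_Integration.integrable_bound[of _ "\<lambda>w. W * ind w"])
    show "AE w in lborel. norm (g w * complex_of_real (exp (- 2 * (cmod w)\<^sup>2))) \<le> norm (W * ind w)"
    proof (intro AE_I2)
      fix w
      have "norm (g w * complex_of_real (exp (- 2 * (cmod w)\<^sup>2))) = (cmod (g w) * exp (- (cmod w)\<^sup>2)) * exp (- (cmod w)\<^sup>2)"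
        by (simp add: norm_mult mult.assoc exp_add[symmetric])
      also have "\<dots> \<le> (cmod (g w) * exp (- (cmod w)\<^sup>2)) * 1"
        by (intro mult_left_mono) auto
      also have "\<dots> \<le> W * ind w"
        using gx[of w] vW[of "?q w - 1" w] conj_exp_gt_1[of w] by simp
      finally show "norm (g w * complex_of_real (exp (- 2 * (cmod w)\<^sup>2))) \<le> norm (W * ind w)" by simp
    qed
  qed (use intind in auto)
  have gR: "cmod w \<le> R" if "g w \<noteq> 0" for w using that ind[of w] by (auto simp: g_def)
  have "cmod (\<Lambda> (fock_proj g)) \<le> K * (B * s)"
    using s1 B_ge_1 m by (intro \<Lambda>_bound \<Lambda>_fock_proj(1)[OF gint gR R] proj_bound) auto
  moreover have "\<Lambda> (fock_proj g) = complex_of_real (K * B * I)"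
  proof -
    have "g w * cnj (rep w) * complex_of_real (exp (- 2 * (cmod w)\<^sup>2)) = complex_of_real (l * (ind w * v w powr ?q w))" for w
    proof (cases "rep w = 0")
      case True
      then show ?thesis by (simp add: v_def)
    next
      case False
      then have vp: "v w > 0" using l by (simp add: v_def)
      have sg: "sgn (rep w) * cnj (rep w) = complex_of_real (cmod (rep w))"
      proof -
        have "sgn (rep w) * cnj (rep w) = complex_of_real (inverse (cmod (rep w))) * (rep w * cnj (rep w))"
          by (simp only: sgn_div_norm scaleR_conv_of_real mult.assoc)
        also have "rep w * cnj (rep w) = complex_of_real ((cmod (rep w))\<^sup>2)"
          by (rule complex_norm_square[symmetric])
        also have "complex_of_real (inverse (cmod (rep w))) * complex_of_real ((cmod (rep w))\<^sup>2) = complex_of_real (cmod (rep w))"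
          using False by (simp only: of_real_mult[symmetric]) (simp add: power2_eq_square)
        finally show ?thesis .
      qed
      have ex: "exp ((cmod w)\<^sup>2) * exp (- 2 * (cmod w)\<^sup>2) = exp (- (cmod w)\<^sup>2)"
        by (simp add: exp_add[symmetric])
      have rv: "exp (- (cmod w)\<^sup>2) * cmod (rep w) = l * v w"
        using l by (simp add: v_def)
      have vq: "v w powr ?q w = v w * v w powr (?q w - 1)"
        using vp by (simp add: powr_mult_base)
      have "g w * cnj (rep w) * complex_of_real (exp (- 2 * (cmod w)\<^sup>2))
          = complex_of_real (ind w * v w powr (?q w - 1) * ((exp ((cmod w)\<^sup>2) * exp (- 2 * (cmod w)\<^sup>2)) * cmod (rep w)))"
        unfolding g_def of_real_mult sg[symmetric] by (simp only: mult_ac)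
      then show ?thesis unfolding ex rv vq by (simp only: mult_ac)
    qed
    then have "pairing g rep = complex_of_real (2 / pi) * complex_of_real (\<integral>w. l * (ind w * v w powr ?q w) \<partial>lborel)"
      by (simp only: pairing_def integral_complex_of_real)
    also have "\<dots> = complex_of_real (2 / pi * (l * I))"
      by (simp add: I_def)
    also have "2 / pi * (l * I) = K * B * I" by (simp add: l_def)
    finally show ?thesis using \<Lambda>_fock_proj(2)[OF gint gR R] by simp
  qed
  ultimately have "K * B * I \<le> K * B * s"
    using K_pos B_ge_1 I by (simp add: norm_mult mult.assoc)
  then have "I \<le> s" using K_pos B_ge_1 by simp
  \<comment> \<open>Here \<open>a > 1\<close> and \<open>I > 1\<close> give the strict inequality
    that yields the contradiction.\<close>
  moreover have "s < I powr 1"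
    unfolding s_def using I a_gt_1 by (intro powr_less_mono) auto
  ultimately show False using I by simp
qed

lemma rep_modular_le_1: "modular (conj_exp p) (\<lambda>w. rep w / complex_of_real (pi / 2 * K * B)) \<le> 1"
proof -
  let ?f = "\<lambda>w. ennreal ((cmod (rep w / complex_of_real (pi / 2 * K * B)) * exp (- (cmod w)\<^sup>2)) powr conj_exp p w)"
  have [measurable]: "rep \<in> borel_measurable borel"
    using holomorphic_on_imp_continuous_on[OF rep_holomorphic] by (rule borel_measurable_continuous_onI)
  have [measurable]: "conj_exp p \<in> borel_measurable borel" by (rule conj.p_measurable)
  have sup: "?f w = (SUP n. indicator (cball 0 (real n)) w * ?f w)" for w
  proof -
    obtain n :: nat where "cmod w \<le> real n" using real_arch_simple by blast
    then have "?f w = indicator (cball 0 (real n)) w * ?f w" by simp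
    then show ?thesis
      by (intro antisym SUP_upper2[of n] SUP_least) (auto simp: indicator_def)
  qed
  have "modular (conj_exp p) (\<lambda>w. rep w / complex_of_real (pi / 2 * K * B)) = (\<integral>\<^sup>+w. (SUP n. indicator (cball 0 (real n)) w * ?f w) \<partial>lborel)"
    unfolding modular_eq using sup by simp
  also have "\<dots> = (SUP n. \<integral>\<^sup>+w. indicator (cball 0 (real n)) w * ?f w \<partial>lborel)"
    by (intro nn_integral_monotone_convergence_SUP)
       (auto simp: incseq_def le_fun_def indicator_def)
  also have "\<dots> \<le> 1"
    by (intro SUP_least rep_modular_cball_le_1) simp
  finally show ?thesis .
qed

lemma rep_Fock: "rep \<in> Fock (conj_exp p)"
proof -
  have "rep \<in> borel_measurable lborel"
    using holomorphic_on_imp_continuous_on[OF rep_holomorphic] by (simp add: borel_measurable_continuous_onI)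
  moreover have "modular (conj_exp p) (\<lambda>w. complex_of_real (1 / (pi / 2 * K * B)) * rep w) < \<infinity>"
  proof -
    have "(\<lambda>w. complex_of_real (1 / (pi / 2 * K * B)) * rep w) = (\<lambda>w. rep w / complex_of_real (pi / 2 * K * B))"
      by (simp add: fun_eq_iff)
    then show ?thesis using rep_modular_le_1 by (auto intro: order_le_less_trans)
  qed
  moreover have "1 / (pi / 2 * K * B) > 0" using K_pos B_ge_1 by simp
  ultimately show ?thesis unfolding Fock_def in_L_def using rep_holomorphic by blast
qed

lemma \<Lambda>_eq_pairing_rep:
  assumes f: "f \<in> Fock p"
  shows "\<Lambda> f = pairing f rep"
proof -
  have fL: "in_L p f" and fh: "f holomorphic_on UNIV" using f by (auto simp: Fock_def)
  have [measurable]: "f \<in> borel_measurable borel" using f by (rule Fock_measurable)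
  have [measurable]: "rep \<in> borel_measurable borel" using rep_Fock by (rule conj.Fock_measurable)
  have [measurable]: "cnj \<in> borel_measurable borel"
    by (intro borel_measurable_continuous_onI continuous_intros)
  define f' where "f' n w = f w * indicator (cball 0 (real n)) w" for n w
  have [measurable]: "f' n \<in> borel_measurable borel" for n unfolding f'_def by measurable
  have f'L: "in_L p (f' n)" for n
  proof -
    have "modular p (f' n) \<le> modular p f"
      by (intro modular_mono) (auto simp: f'_def indicator_def)
    then show ?thesis using fL by (auto simp: in_L_iff intro: order_le_less_trans)
  qed
  have int: "integrable lborel (\<lambda>z. f z * cnj (rep z) * complex_of_real (exp (- 2 * (cmod z)\<^sup>2)))"
  proof -
    obtain s where "s > 0" "modular p (\<lambda>z. f z / complex_of_real s) \<le> 1"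
      using fL by (rule in_L_admissible_scale)
    then show ?thesis
      by (rule pairing_Young(1)[OF _ _ _ _ _ rep_modular_le_1, rotated 2]) (use K_pos B_ge_1 in auto)
  qed
  have f'int: "integrable lborel (\<lambda>w. f' n w * complex_of_real (exp (- 2 * (cmod w)\<^sup>2)))" for n
    using integrable_fock_kernel[OF f'L[of n], of 0] by simp
  have f'R: "cmod w \<le> real n" if "f' n w \<noteq> 0" for n w
    using that by (auto simp: f'_def indicator_def split: if_splits)
  have ev: "\<forall>\<^sub>F n in sequentially. f' n w = f w" for w
    using eventually_ge_at_top[of "nat \<lceil>cmod w\<rceil>"]
    by eventually_elim (auto simp: f'_def indicator_def nat_ceiling_le_eq)
  have "(\<lambda>n. pairing (f' n) rep) \<longlonglongrightarrow> pairing f rep"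
    unfolding pairing_def
  proof (intro tendsto_mult_left integral_dominated_convergence[OF _ _ integrable_norm[OF int]])
    show "AE w in lborel. (\<lambda>n. f' n w * cnj (rep w) * complex_of_real (exp (- 2 * (cmod w)\<^sup>2)))
        \<longlonglongrightarrow> f w * cnj (rep w) * complex_of_real (exp (- 2 * (cmod w)\<^sup>2))"
      by (intro AE_I2 tendsto_mult_right tendsto_eventually[OF ev])
  qed (auto simp: f'_def indicator_def norm_mult)
  then have lim1: "(\<lambda>n. \<Lambda> (fock_proj (f' n))) \<longlonglongrightarrow> pairing f rep"
    using \<Lambda>_fock_proj(2)[OF f'int f'R] by simp
  \<comment> \<open>At any fixed scale \<open>d\<close> the modular of the truncation error tends to
    0 by dominated convergence. Once it is below 1, the bounds on the projection and on
    \<open>\<Lambda>\<close> give an error of at most \<open>K * B * d\<close>.\<close>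
  have lim2: "(\<lambda>n. \<Lambda> (fock_proj (f' n))) \<longlonglongrightarrow> \<Lambda> f"
  proof (rule tendstoI)
    fix e :: real assume e: "e > 0"
    \<comment> \<open>The factor 2 makes the final error \<open>e / 2\<close>, strictly below
      \<open>e\<close>.\<close>
    define d where "d = e / (2 * K * B)"
    have d: "d > 0" using e K_pos B_ge_1 by (simp add: d_def)
    let ?F = "\<lambda>w. (cmod (f w / complex_of_real d) * exp (- (cmod w)\<^sup>2)) powr p w"
    let ?D = "\<lambda>n w. f w - f' n w"
    have Dle: "cmod (?D n w) \<le> cmod (f w)" for n w by (auto simp: f'_def indicator_def)
    have fin: "modular p (\<lambda>w. f w / complex_of_real d) < top"
      using modular_cmult_finite[of f "1 / complex_of_real d"] fL by (simp add: in_L_iff)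
    have "(\<lambda>n. modular p (\<lambda>w. ?D n w / complex_of_real d)) \<longlonglongrightarrow> (\<integral>\<^sup>+w. 0 \<partial>(lborel :: complex measure))"
      unfolding modular_eq
    proof (rule nn_integral_dominated_convergence[where w = "\<lambda>w. ennreal (?F w)"])
      show "AE w in lborel. ennreal ((cmod (?D n w / complex_of_real d) * exp (- (cmod w)\<^sup>2)) powr p w) \<le> ennreal (?F w)" for n
        using Dle d p_ge_1 
        by (intro AE_I2 ennreal_leI powr_mono2 mult_right_mono) (auto simp: norm_divide divide_right_mono intro: order_trans[OF zero_le_one])
      show "(\<integral>\<^sup>+w. ennreal (?F w) \<partial>lborel) < \<infinity>" using fin by (simp add: modular_eq)
      show "AE w in lborel. (\<lambda>n. ennreal ((cmod (?D n w / complex_of_real d) * exp (- (cmod w)\<^sup>2)) powr p w)) \<longlonglongrightarrow> 0"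
      proof (intro AE_I2 tendsto_eventually)
        show "\<forall>\<^sub>F n in sequentially. ennreal ((cmod (?D n w / complex_of_real d) * exp (- (cmod w)\<^sup>2)) powr p w) = 0" for w
          using ev[of w] by eventually_elim simp
      qed
    qed measurable
    then have "(\<lambda>n. modular p (\<lambda>w. ?D n w / complex_of_real d)) \<longlonglongrightarrow> 0" by simp
    then have "\<forall>\<^sub>F n in sequentially. modular p (\<lambda>w. ?D n w / complex_of_real d) < 1"
      by (rule order_tendstoD) simp
    then show "\<forall>\<^sub>F n in sequentially. dist (\<Lambda> (fock_proj (f' n))) (\<Lambda> f) < e"
    proof eventually_elim
      case (elim n)
      have "fock_proj (?D n) z = f z - fock_proj (f' n) z" for z
      proof -
        have "fock_proj (?D n) z = fock_proj f z - fock_proj (f' n) z"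
          unfolding fock_proj_def right_diff_distrib[symmetric]
          by (subst Bochner_Integration.integral_diff[symmetric, OF integrable_fock_kernel[OF fL] integrable_fock_kernel[OF f'L]])
             (simp add: algebra_simps)
        also have "fock_proj f z = f z"
          unfolding fock_proj_def by (rule fock_reproducing[OF fh integrable_fock_kernel[OF fL]])
        finally show ?thesis .
      qed
      then have eq: "fock_proj (?D n) = (\<lambda>z. f z - fock_proj (f' n) z)" by auto
      have pF: "fock_proj (f' n) \<in> Fock p"
        using \<Lambda>_fock_proj(1)[OF f'int f'R] by simp
      have "modular p (\<lambda>z. fock_proj (?D n) z / complex_of_real (B * d)) \<le> 1"
        using elim d by (intro proj_bound) auto
      then have "cmod (\<Lambda> (\<lambda>z. f z - fock_proj (f' n) z)) \<le> K * (B * d)"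
        using d B_ge_1 unfolding eq by (intro \<Lambda>_bound \<Lambda>_diff(1)[OF f pF]) auto
      also have "K * (B * d) < e" using K_pos B_ge_1 e by (simp add: d_def)
      finally show ?case
        by (simp add: \<Lambda>_diff(2)[OF f pF] dist_norm norm_minus_commute)
    qed
  qed
  show ?thesis by (rule LIMSEQ_unique[OF lim2 lim1])
qed

end

section \<open>Continuity of the exponent and pointwise bounds\<close>

lemma AE_closed_imp_all:
  fixes p :: "complex \<Rightarrow> real"
  assumes p: "continuous_on UNIV p" and S: "closed S" and AE: "AE z in lborel. p z \<in> S"
  shows "p z \<in> S"
proof (rule ccontr)
  assume "p z \<notin> S"
  \<comment> \<open>The exceptional set is open by continuity and null by assumption, hence
    empty.\<close>
  define U where "U = p -` (- S)"
  have U: "open U" unfolding U_def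
    using S by (intro open_vimage p) auto
  have "U \<in> null_sets lborel"
    using AE U by (subst AE_iff_null_sets) (auto simp: U_def)
  then have "negligible U"
    by (simp add: negligible_iff_null_sets null_sets_completionI)
  moreover have "U \<noteq> {}" using \<open>p z \<notin> S\<close> by (auto simp: U_def)
  ultimately show False using open_not_negligible[OF U] by blast
qed

lemma Plog_continuous:
  assumes "Plog p"
  shows "continuous_on UNIV p"
proof -
  obtain L where L: "L > 0" "\<And>z w. 0 < cmod (z - w) \<Longrightarrow> cmod (z - w) < 1/2 \<Longrightarrow> \<bar>p z - p w\<bar> \<le> L / ln (1 / cmod (z - w))"
    using assms unfolding Plog_def by blast
  show ?thesis
    unfolding continuous_on_iff
  proof (intro ballI allI impI)
    fix z :: complex and e :: real assume e: "e > 0"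
    \<comment> \<open>The second entry is the distance at which the modulus of continuity
      \<open>L / ln (1 / r)\<close> equals \<open>e\<close>.\<close>
    define d where "d = min (1/2) (exp (- L / e))"
    have "dist (p w) (p z) < e" if "dist w z < d" for w
    proof (cases "w = z")
      case False
      define r where "r = cmod (z - w)"
      have r: "0 < r" "r < 1/2" "r < exp (- L / e)"
        using that False by (auto simp: r_def d_def dist_norm norm_minus_commute)
      have "ln r < - L / e" using r by (metis ln_exp ln_less_cancel_iff exp_gt_zero)
      then have "L / e < ln (1 / r)" using r by (simp add: ln_div)
      then have "L < e * ln (1 / r)" using e by (simp add: field_simps)
      moreover have "0 < ln (1 / r)" using r by simp
      ultimately have "L / ln (1 / r) < e" by (simp add: field_simps)
      then show ?thesis
        using L(2)[of z w] r by (simp add: r_def dist_real_def abs_minus_commute)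
    qed (use e in simp)
    moreover have "d > 0" by (simp add: d_def)
    ultimately show "\<exists>d>0. \<forall>w\<in>UNIV. dist w z < d \<longrightarrow> dist (p w) (p z) < e" by blast
  qed
qed

lemma Plog_log_exponent:
  assumes "Plog p"
  obtains a b pinf C where "log_exponent p b a pinf C"
proof -
  note cont = Plog_continuous[OF assms]
  obtain a b pinf C where *: "1 < a" "AE z in lborel. a \<le> p z" "AE z in lborel. p z \<le> b" "1 \<le> pinf"
      "\<And>z. \<bar>p z - pinf\<bar> \<le> C / ln (exp 1 + cmod z)" "\<And>z. 1 \<le> p z"
    using assms unfolding Plog_def by blast
  have "a \<le> p z" "p z \<le> b" for z
    using AE_closed_imp_all[OF cont closed_atLeast[of a]] AE_closed_imp_all[OF cont closed_atMost[of b]] *(2,3)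
    by auto
  then have "log_exponent p b a pinf C"
    using * cont by unfold_locales (auto intro: borel_measurable_continuous_onI)
  then show ?thesis by (rule that)
qed

section \<open>The pairing between the two Fock spaces and its operator norm\<close>

context log_exponent
begin

lemma pairing_integrable:
  assumes f: "f \<in> Fock p" and h: "h \<in> Fock (conj_exp p)"
  shows "integrable lborel (\<lambda>z. f z * cnj (h z) * complex_of_real (exp (- 2 * (cmod z)\<^sup>2)))"
proof -
  have "in_L p f" "in_L (conj_exp p) h" using f h by (auto simp: Fock_def)
  then obtain s t where "s > 0" "modular p (\<lambda>z. f z / complex_of_real s) \<le> 1"
    "t > 0" "modular (conj_exp p) (\<lambda>z. h z / complex_of_real t) \<le> 1"
    by (metis in_L_admissible_scale conj.in_L_admissible_scale)
  then show ?thesis by (rule pairing_Young(1)[OF Fock_measurable[OF f] conj.Fock_measurable[OF h]])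
qed

lemma pairing_add_left:
  assumes "f \<in> Fock p" "g \<in> Fock p" "h \<in> Fock (conj_exp p)"
  shows "pairing (\<lambda>z. f z + g z) h = pairing f h + pairing g h"
  unfolding pairing_def distrib_left[symmetric]
  by (subst Bochner_Integration.integral_add[symmetric, OF pairing_integrable pairing_integrable])
     (use assms in \<open>auto simp: algebra_simps\<close>)

lemma pairing_cmult_left: "pairing (\<lambda>z. c * f z) h = c * pairing f h"
proof -
  have "(\<lambda>z. c * f z * cnj (h z) * complex_of_real (exp (- 2 * (cmod z)\<^sup>2)))
      = (\<lambda>z. c * (f z * cnj (h z) * complex_of_real (exp (- 2 * (cmod z)\<^sup>2))))"
    by (simp add: mult_ac)
  then show ?thesis unfolding pairing_def by (simp only: integral_mult_right_zero mult.left_commute)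
qed

lemma pairing_le:
  assumes f: "f \<in> Fock p" and h: "h \<in> Fock (conj_exp p)"
  shows "cmod (pairing f h) \<le> 2 * L_norm p f * L_norm (conj_exp p) h"
proof -
  have fL: "in_L p f" and hL: "in_L (conj_exp p) h" using f h by (auto simp: Fock_def)
  \<comment> \<open>Every scale strictly above a norm is admissible, so Young's inequality holds
    with both norms increased by \<open>e\<close>; letting \<open>e\<close> tend to 0 also covers
    norms that are not attained or vanish.\<close>
  let ?b = "\<lambda>e. 2 * (L_norm p f + e) * (L_norm (conj_exp p) h + e)"
  have "cmod (pairing f h) \<le> ?b e" if "e > 0" for e
    using that L_norm_nonneg[OF fL] conj.L_norm_nonneg[OF hL]
    by (intro pairing_Young(2) Fock_measurable[OF f] conj.Fock_measurable[OF h]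
        modular_le_1_of_L_norm_less[OF fL] conj.modular_le_1_of_L_norm_less[OF hL]) auto
  then have "\<forall>\<^sub>F e in at_right 0. cmod (pairing f h) \<le> ?b e"
    by (auto simp: eventually_at_filter)
  moreover have "(?b \<longlongrightarrow> 2 * (L_norm p f + 0) * (L_norm (conj_exp p) h + 0)) (at_right 0)"
    by (intro tendsto_intros)
  ultimately show ?thesis
    using tendsto_lowerbound[of ?b _ "at_right 0" "cmod (pairing f h)"] by simp
qed

lemma bounded_functional_pairing:
  assumes h: "h \<in> Fock (conj_exp p)"
  shows "bounded_functional p (\<lambda>f. pairing f h)"
  unfolding bounded_functional_def
proof (intro conjI ballI allI exI)
  show "cmod (pairing f h) \<le> (2 * L_norm (conj_exp p) h) * L_norm p f" if "f \<in> Fock p" for f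
    using pairing_le[OF that h] by (simp add: mult_ac)
qed (use h in \<open>auto simp: pairing_add_left pairing_cmult_left\<close>)

lemma L_norm_0_le: "L_norm p (\<lambda>z. 0) \<le> 1"
  by (rule L_norm_le) (auto simp: modular_eq)

lemma op_norm_pairing_le:
  assumes h: "h \<in> Fock (conj_exp p)"
  shows "op_norm p (\<lambda>f. pairing f h) \<le> 2 * L_norm (conj_exp p) h"
    and "f \<in> Fock p \<Longrightarrow> t > 0 \<Longrightarrow> modular p (\<lambda>z. f z / complex_of_real t) \<le> 1 \<Longrightarrow>
      cmod (pairing f h) \<le> op_norm p (\<lambda>f. pairing f h) * t"
    and "0 \<le> op_norm p (\<lambda>f. pairing f h)"
proof -
  let ?S = "{cmod (pairing f h) |f. f \<in> Fock p \<and> L_norm p f \<le> 1}"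
  have h0: "0 \<le> L_norm (conj_exp p) h" using h by (intro conj.L_norm_nonneg) (simp add: Fock_def)
  have le: "x \<le> 2 * L_norm (conj_exp p) h" if x: "x \<in> ?S" for x
  proof -
    obtain f where f: "x = cmod (pairing f h)" "f \<in> Fock p" "L_norm p f \<le> 1" using x by blast
    have "x \<le> L_norm p f * (2 * L_norm (conj_exp p) h)"
      using pairing_le[OF f(2) h] by (simp add: f(1) mult_ac)
    also have "\<dots> \<le> 1 * (2 * L_norm (conj_exp p) h)"
      using f h0 by (intro mult_right_mono) auto
    finally show ?thesis by simp
  qed
  \<comment> \<open>The real supremum is meaningful only for a nonempty set that is bounded above;
    the zero function provides an element.\<close>
  have z: "cmod (pairing (\<lambda>z. 0) h) \<in> ?S" using Fock_0 L_norm_0_le by blast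
  show "op_norm p (\<lambda>f. pairing f h) \<le> 2 * L_norm (conj_exp p) h"
    unfolding op_norm_def by (rule cSup_least) (use z le in blast)+
  have bdd: "bdd_above ?S" using le by (rule bdd_aboveI)
  show "0 \<le> op_norm p (\<lambda>f. pairing f h)"
    unfolding op_norm_def by (rule order_trans[OF norm_ge_zero cSup_upper[OF z bdd]])
  assume f: "f \<in> Fock p" and t: "t > 0" "modular p (\<lambda>z. f z / complex_of_real t) \<le> 1"
  let ?g = "\<lambda>z. 1 / complex_of_real t * f z"
  have "L_norm p ?g \<le> 1" using t by (intro L_norm_le) (simp_all add: field_simps)
  then have "cmod (pairing ?g h) \<le> op_norm p (\<lambda>f. pairing f h)"
    unfolding op_norm_def using Fock_cmult[OF f, of "1 / complex_of_real t"] by (intro cSup_upper[OF _ bdd]) blast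
  then show "cmod (pairing f h) \<le> op_norm p (\<lambda>f. pairing f h) * t"
    using t unfolding pairing_cmult_left by (simp add: norm_divide norm_mult field_simps)
qed

text \<open>Conjugation exchanges \<open>z\<close> and \<open>w\<close> in the kernel, which leaves
  the reproducing formula for \<open>h\<close>. This identifies \<open>rep\<close> with
  \<open>h\<close> for the functional induced by \<open>h\<close>.\<close>

lemma pairing_kernel:
  assumes h: "h \<in> Fock (conj_exp p)"
  shows "cnj (pairing (\<lambda>z. exp (2 * z * cnj w)) h) = h w"
proof -
  have h': "h holomorphic_on UNIV" "in_L (conj_exp p) h" using h by (auto simp: Fock_def)
  have eq: "cnj (exp (2 * z * cnj w) * cnj (h z) * complex_of_real (exp (- 2 * (cmod z)\<^sup>2)))
      = h z * exp (2 * w * cnj z) * complex_of_real (exp (- 2 * (cmod z)\<^sup>2))" for z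
    by (simp add: exp_cnj mult_ac)
  have "cnj (pairing (\<lambda>z. exp (2 * z * cnj w)) h) = complex_of_real (2 / pi) *
      (\<integral>z. h z * exp (2 * w * cnj z) * complex_of_real (exp (- 2 * (cmod z)\<^sup>2)) \<partial>lborel)"
    unfolding pairing_def eq[symmetric] Bochner_Integration.integral_cnj by (simp only: complex_cnj_mult complex_cnj_complex_of_real)
  also have "\<dots> = h w"
    by (rule fock_reproducing[OF h'(1) conj.integrable_fock_kernel[OF h'(2)]])
  finally show ?thesis .
qed

end

text \<open>The integrability conjunct excludes the default value 0 of the Bochner integral, so that
  \<open>pairing\<close> is a genuine integral on these spaces.\<close>

theorem mainTheorem9:
  fixes p :: "complex \<Rightarrow> real"
  assumes "Plog p"
  shows "(\<forall>h\<in>Fock (conj_exp p). \<forall>f\<in>Fock p.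
            integrable lborel (\<lambda>z. f z * cnj (h z) * complex_of_real (exp (- 2 * (cmod z)\<^sup>2))))
       \<and> (\<forall>h\<in>Fock (conj_exp p). bounded_functional p (\<lambda>f. pairing f h))
       \<and> (\<forall>\<Lambda>. bounded_functional p \<Lambda> \<longrightarrow>
            (\<exists>h\<in>Fock (conj_exp p). \<forall>f\<in>Fock p. \<Lambda> f = pairing f h))
       \<and> (\<exists>C>0. \<forall>h\<in>Fock (conj_exp p).
            op_norm p (\<lambda>f. pairing f h) \<le> C * L_norm (conj_exp p) h \<and>
            L_norm (conj_exp p) h \<le> C * op_norm p (\<lambda>f. pairing f h))"
proof -
  obtain a b pinf C where "log_exponent p b a pinf C"
    by (rule Plog_log_exponent[OF assms])
  then interpret log_exponent p b a pinf C .
  obtain B where B: "B \<ge> 1" "\<And>g s. g \<in> borel_measurable borel \<Longrightarrow> s > 0 \<Longrightarrow>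
    modular p (\<lambda>z. g z / complex_of_real s) \<le> 1 \<Longrightarrow>
    modular p (\<lambda>z. fock_proj g z / complex_of_real (B * s)) \<le> 1"
    by (rule fock_proj_modular_bounded) blast
  have rep: "\<exists>h\<in>Fock (conj_exp p). \<forall>f\<in>Fock p. \<Lambda> f = pairing f h" if \<Lambda>: "bounded_functional p \<Lambda>" for \<Lambda>
  proof -
    obtain M where M: "\<And>f. f \<in> Fock p \<Longrightarrow> cmod (\<Lambda> f) \<le> M * L_norm p f"
      using \<Lambda> unfolding bounded_functional_def by blast
    \<comment> \<open>The constant \<open>M\<close> in the definition of boundedness may be zero or
      negative, while the locale asks for a positive bound.\<close>
    have bound: "cmod (\<Lambda> f) \<le> (\<bar>M\<bar> + 1) * t"
      if f: "f \<in> Fock p" and t: "t > 0" "modular p (\<lambda>z. f z / complex_of_real t) \<le> 1" for f t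
    proof -
      have "0 \<le> L_norm p f" using f by (intro L_norm_nonneg) (simp add: Fock_def)
      then have "M * L_norm p f \<le> (\<bar>M\<bar> + 1) * t"
        using L_norm_le[OF t] by (intro mult_mono) auto
      then show ?thesis using M[OF f] by simp
    qed
    interpret log_fock_functional p b a pinf C \<Lambda> "\<bar>M\<bar> + 1" B
      by unfold_locales (use B \<Lambda> bound in \<open>auto simp: bounded_functional_def\<close>)
    show ?thesis using rep_Fock \<Lambda>_eq_pairing_rep by blast
  qed
  have lower: "L_norm (conj_exp p) h \<le> pi / 2 * B * op_norm p (\<lambda>f. pairing f h)"
    if h: "h \<in> Fock (conj_exp p)" for h
  proof (rule field_le_epsilon)
    fix e :: real assume e: "e > 0"
    \<comment> \<open>\<open>op_norm\<close> may be 0, so it is increased by \<open>d\<close> to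
      give a positive bound; this choice makes the resulting error exactly \<open>e\<close>.\<close>
    define d where "d = e / (pi / 2 * B)"
    have d: "d > 0" using e B(1) by (simp add: d_def)
    let ?K = "op_norm p (\<lambda>f. pairing f h) + d"
    have bound: "cmod (pairing f h) \<le> ?K * t"
      if "f \<in> Fock p" "t > 0" "modular p (\<lambda>z. f z / complex_of_real t) \<le> 1" for f t
    proof -
      have "op_norm p (\<lambda>f. pairing f h) * t \<le> ?K * t"
        using that d by (intro mult_right_mono) auto
      then show ?thesis using op_norm_pairing_le(2)[OF h that] by linarith
    qed
    have K: "?K > 0" using d op_norm_pairing_le(3)[OF h] by linarith
    interpret log_fock_functional p b a pinf C "\<lambda>f. pairing f h" ?K B
      by unfold_locales (use B bound K h in \<open>auto simp: pairing_add_left pairing_cmult_left\<close>)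
    have "rep = h" unfolding rep_def[abs_def] pairing_kernel[OF h] ..
    then have "L_norm (conj_exp p) h \<le> pi / 2 * ?K * B"
      using rep_modular_le_1 K B(1) by (intro L_norm_le) auto
    also have "\<dots> = pi / 2 * B * op_norm p (\<lambda>f. pairing f h) + e"
      using B(1) by (simp add: d_def field_simps)
    finally show "L_norm (conj_exp p) h \<le> pi / 2 * B * op_norm p (\<lambda>f. pairing f h) + e" .
  qed
  have "\<exists>C>0. \<forall>h\<in>Fock (conj_exp p).
            op_norm p (\<lambda>f. pairing f h) \<le> C * L_norm (conj_exp p) h \<and>
            L_norm (conj_exp p) h \<le> C * op_norm p (\<lambda>f. pairing f h)"
  \<comment> \<open>The sum of the two one-sided constants serves both inequalities, since both
    norms are nonnegative.\<close>
  proof (intro exI[of _ "2 + pi / 2 * B"] conjI ballI)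
    show "0 < 2 + pi / 2 * B" using B(1) by (simp add: add_pos_nonneg)
    fix h assume h: "h \<in> Fock (conj_exp p)"
    have h0: "0 \<le> L_norm (conj_exp p) h" using h by (intro conj.L_norm_nonneg) (simp add: Fock_def)
    have "2 * L_norm (conj_exp p) h \<le> (2 + pi / 2 * B) * L_norm (conj_exp p) h"
      using B(1) h0 by (intro mult_right_mono) auto
    then show "op_norm p (\<lambda>f. pairing f h) \<le> (2 + pi / 2 * B) * L_norm (conj_exp p) h"
      using op_norm_pairing_le(1)[OF h] by linarith
    have "pi / 2 * B * op_norm p (\<lambda>f. pairing f h) \<le> (2 + pi / 2 * B) * op_norm p (\<lambda>f. pairing f h)"
      using op_norm_pairing_le(3)[OF h] by (intro mult_right_mono) auto
    then show "L_norm (conj_exp p) h \<le> (2 + pi / 2 * B) * op_norm p (\<lambda>f. pairing f h)"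
      using lower[OF h] by linarith
  qed
  then show ?thesis
    using pairing_integrable bounded_functional_pairing rep by blast
qed

end
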